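(* Let $\mathfrak m$ be an infinite cardinal satisfying $\sup\{\mathfrak m^{\mathfrak n} : \mathfrak n<\mathfrak m\}=\mathfrak m$. Every metrizable SIN topological group of weight $\le\mathfrak m$ embeds into $\mathrm{Iso}(\mathbb U_{\mathfrak m})$, that is, it is isomorphic (as a topological group) to a topological subgroup of $\mathrm{Iso}(\mathbb U_{\mathfrak m})$.
   Context: For an infinite cardinal $\mathfrak m$ with $\sup\{\mathfrak m^{\mathfrak n}:\mathfrak n<\mathfrak m\}=\mathfrak m$, $\mathbb U_{\mathfrak m}$ denotes the Urysohn--Katětov space: the complete metric space of weight $\mathfrak m$, unique up to isometry (Katětov), which contains an isometric copy of every metric space of weight $\le\mathfrak m$ and is $<\mathfrak m$-homogeneous: every isometry between two metric subspaces of density $<\mathfrak m$ (for $\mathfrak m=\aleph_0$: finite subspaces) extends to a self-isometry of the whole space. It can be obtained from any nonempty metric space $X$ of weight $\le\mathfrak m$ as follows. A $1$-Lipschitz function $f:X\to\mathbb R$ is a Katětov function if $d(x,y)\le f(x)+f(y)$ for all $x,y\in X$. Let $E(X)$ be the set of Katětov functions on $X$ with the supremum metric, and let $E_{\mathfrak m}(X)$ be the subspace of those $f$ for which there is a nonempty $A\subseteq X$ of cardinality $<\mathfrak m$ with $f(x)=\inf_{a\in A}(f(a)+d(x,a))$ for all $x\in X$. $X$ embeds isometrically in $E_{\mathfrak m}(X)$ via $x\mapsto d(x,-)$. Iterating $X\mapsto E_{\mathfrak m}(X)$ transfinitely $\mathfrak m$ times (taking unions at limit steps) and completing the union yields $\mathbb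 U_{\mathfrak m}$. $\mathrm{Iso}(\mathbb U_{\mathfrak m})$ is the group of isometries of $\mathbb U_{\mathfrak m}$ with the topology of simple (pointwise) convergence; a neighbourhood basis at the identity consists of the sets $\{g : d(x_i,gx_i)<\varepsilon,\ i=1,\dots,n\}$ with $x_1,\dots,x_n\in\mathbb U_{\mathfrak m}$ and $\varepsilon>0$. The weight of a topological space is the smallest cardinality of a base; the density is the smallest cardinality of a dense subset. A topological group is SIN if it has a basis at the identity consisting of open conjugation-invariant neighbourhoods; equivalently, its left and right uniform structures coincide. *)

theory Defs
  imports "HOL-Analysis.Analysis" "HOL-Algebra.Bij"
begin

unbundle cardinal_syntax

text \<open>Cardinals are represented, as in the library, by cardinal orders \<open>m :: 'k rel\<close>
  satisfying \<^const>\<open>Card_order\<close>, compared by \<open>\<le>o\<close>, \<open><o\<close> and \<open>=o\<close> across types.\<close>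

section \<open>Weight and density\<close>

definition least_card :: "('a set \<Rightarrow> bool) \<Rightarrow> 'a rel" where
  "least_card P = card_of (SOME S. P S \<and> (\<forall>S'. P S' \<longrightarrow> |S| \<le>o |S'| ))"

lemma least_card_witness:
  assumes "P S"
  shows "\<exists>S0. P S0 \<and> least_card P = |S0| \<and> (\<forall>S'. P S' \<longrightarrow> |S0| \<le>o |S'| )"
proof -
  let ?R = "card_of ` Collect P"
  have "\<exists>r\<in>?R. \<forall>r'\<in>?R. r \<le>o r'"
    by (rule exists_minim_Card_order) (use assms card_of_Card_order in auto)
  then have "\<exists>S. P S \<and> (\<forall>S'. P S' \<longrightarrow> |S| \<le>o |S'| )"
    by auto
  from someI_ex[OF this] show ?thesis
    unfolding least_card_def by blast
qed

definition is_base :: "'a topology \<Rightarrow> 'a set set \<Rightarrow> bool" where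
  "is_base X \<B> \<longleftrightarrow> (\<forall>V\<in>\<B>. openin X V) \<and>
     (\<forall>U x. openin X U \<and> x \<in> U \<longrightarrow> (\<exists>V\<in>\<B>. x \<in> V \<and> V \<subseteq> U))"

definition top_weight :: "'a topology \<Rightarrow> 'a set rel" where
  "top_weight X = least_card (is_base X)"

definition top_density :: "'a topology \<Rightarrow> 'a rel" where
  "top_density X = least_card (\<lambda>S. S \<subseteq> topspace X \<and> Abstract_Topology.closure_of X S = topspace X)"

lemma top_weight_witness:
  "\<exists>\<B>. is_base X \<B> \<and> top_weight X = |\<B>| \<and> (\<forall>\<B>'. is_base X \<B>' \<longrightarrow> |\<B>| \<le>o |\<B>'| )"
proof -
  have "is_base X (Collect (openin X))"
    unfolding is_base_def by auto
  from least_card_witness[of "is_base X", OF this] show ?thesis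
    unfolding top_weight_def .
qed

lemma top_weight_le: "is_base X \<B> \<Longrightarrow> top_weight X \<le>o |\<B>|"
  using top_weight_witness[of X] by auto

lemma top_density_witness:
  "\<exists>S. S \<subseteq> topspace X \<and> Abstract_Topology.closure_of X S = topspace X \<and> top_density X = |S| \<and>
     (\<forall>S'. S' \<subseteq> topspace X \<and> Abstract_Topology.closure_of X S' = topspace X \<longrightarrow> |S| \<le>o |S'| )"
proof -
  have "topspace X \<subseteq> topspace X \<and> Abstract_Topology.closure_of X (topspace X) = topspace X"
    by simp
  from least_card_witness[of "\<lambda>S. S \<subseteq> topspace X \<and> Abstract_Topology.closure_of X S = topspace X", OF this]
  show ?thesis
    unfolding top_density_def by simp
qed

section \<open>Suprema of sets of cardinals\<close>

text \<open>The competing upper bounds \<open>k\<close> may be taken on the type of \<open>m\<close>, because every cardinal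
  below \<open>m\<close> is represented there.\<close>

definition is_cardinal_sup :: "'a rel set \<Rightarrow> 'k rel \<Rightarrow> bool" where
  "is_cardinal_sup S m \<longleftrightarrow> Card_order m \<and> (\<forall>r\<in>S. r \<le>o m) \<and>
     (\<forall>k :: 'k rel. Card_order k \<and> (\<forall>r\<in>S. r \<le>o k) \<longrightarrow> m \<le>o k)"

section \<open>Isometries\<close>

definition isometric_map :: "'a metric \<Rightarrow> 'b metric \<Rightarrow> ('a \<Rightarrow> 'b) \<Rightarrow> bool" where
  "isometric_map X Y f \<longleftrightarrow> f \<in> mspace X \<rightarrow> mspace Y \<and>
     (\<forall>x\<in>mspace X. \<forall>y\<in>mspace X. mdist Y (f x) (f y) = mdist X x y)"

definition isometry_group :: "'a metric \<Rightarrow> ('a \<Rightarrow> 'a) monoid" where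
  "isometry_group X = BijGroup (mspace X) \<lparr>carrier := {f \<in> Bij (mspace X). isometric_map X X f}\<rparr>"

text \<open>The topology of pointwise convergence. The elements of the isometry group are extensional
  functions, hence points of the product of copies of \<open>X\<close> indexed by \<open>mspace X\<close>.\<close>

definition isometry_topology :: "'a metric \<Rightarrow> ('a \<Rightarrow> 'a) topology" where
  "isometry_topology X =
     subtopology (product_topology (\<lambda>_. mtopology_of X) (mspace X)) (carrier (isometry_group X))"

lemma group_isometry_group: "group (isometry_group X)"
proof -
  let ?I = "{f \<in> Bij (mspace X). isometric_map X X f}"
  have eq: "isometry_group X = BijGroup (mspace X) \<lparr>carrier := ?I\<rparr>"
    by (simp add: isometry_group_def)
  interpret B: group "BijGroup (mspace X)" by (rule group_BijGroup)
  have "subgroup ?I (BijGroup (mspace X))"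
  proof (rule B.subgroupI)
    show "?I \<subseteq> carrier (BijGroup (mspace X))" by (auto simp: BijGroup_def)
    have "(\<lambda>x\<in>mspace X. x) \<in> ?I" by (auto simp: isometric_map_def id_Bij)
    then show "?I \<noteq> {}" by blast
  next
    fix f assume f: "f \<in> ?I"
    then have b: "bij_betw f (mspace X) (mspace X)" by (auto simp: Bij_def)
    have inv: "inv\<^bsub>BijGroup (mspace X)\<^esub> f = (\<lambda>x\<in>mspace X. inv_into (mspace X) f x)"
      using f by (auto intro: inv_BijGroup)
    have "isometric_map X X (\<lambda>x\<in>mspace X. inv_into (mspace X) f x)"
      unfolding isometric_map_def
    proof (intro conjI ballI)
      show "(\<lambda>x\<in>mspace X. inv_into (mspace X) f x) \<in> mspace X \<rightarrow> mspace X"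
        using b by (auto simp: bij_betw_def inv_into_into)
      fix x y assume xy: "x \<in> mspace X" "y \<in> mspace X"
      have "mdist X (f (inv_into (mspace X) f x)) (f (inv_into (mspace X) f y))
          = mdist X (inv_into (mspace X) f x) (inv_into (mspace X) f y)"
        using f xy b by (auto simp: isometric_map_def bij_betw_def inv_into_into)
      moreover have "f (inv_into (mspace X) f x) = x" "f (inv_into (mspace X) f y) = y"
        using xy b by (auto simp: bij_betw_inv_into_right)
      ultimately show "mdist X ((\<lambda>x\<in>mspace X. inv_into (mspace X) f x) x)
          ((\<lambda>x\<in>mspace X. inv_into (mspace X) f x) y) = mdist X x y"
        using xy by simp
    qed
    then show "inv\<^bsub>BijGroup (mspace X)\<^esub> f \<in> ?I"
      unfolding inv using f by (auto intro: restrict_inv_into_Bij)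
  next
    fix f g assume fg: "f \<in> ?I" "g \<in> ?I"
    then show "f \<otimes>\<^bsub>BijGroup (mspace X)\<^esub> g \<in> ?I"
      by (auto simp: BijGroup_def compose_Bij[unfolded compose_def] isometric_map_def compose_def Pi_iff)
  qed
  then show ?thesis
    unfolding eq by (rule B.subgroup_imp_group)
qed

section \<open>The Urysohn--Katetov space\<close>

text \<open>A metric space of weight at most \<open>m :: 'k rel\<close> has a dense subset that injects into \<open>'k\<close>, and
  each of its points is the limit of a sequence in that subset; so up to isometry all such spaces
  have their points in the type \<^typ>\<open>nat \<Rightarrow> 'k\<close>, and universality may be stated for these. The
  lemma \<open>urysohn_katetov_universal\<close> below removes the restriction.

  For \<open>m =o natLeq\<close>, a metric space of density below \<open>m\<close> is the same as a finite one.\<close>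

definition urysohn_katetov :: "'k rel \<Rightarrow> 'u metric \<Rightarrow> bool" where
  "urysohn_katetov m U \<longleftrightarrow>
     mcomplete_of U \<and>
     (top_weight (mtopology_of U), m) \<in> ordIso \<and>
     (\<forall>X :: (nat \<Rightarrow> 'k) metric. top_weight (mtopology_of X) \<le>o m \<longrightarrow> (\<exists>f. isometric_map X U f)) \<and>
     (\<forall>A B f. A \<subseteq> mspace U \<and> B \<subseteq> mspace U \<and>
        top_density (mtopology_of (submetric U A)) <o m \<and>
        top_density (mtopology_of (submetric U B)) <o m \<and>
        isometric_map (submetric U A) (submetric U B) f \<and> f ` A = B \<longrightarrow>
        (\<exists>g\<in>carrier (isometry_group U). \<forall>x\<in>A. g x = f x))"

lemma weight_transfer:
  fixes h :: "'a \<Rightarrow> 'b"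
  assumes h: "homeomorphic_map X Y h" and "is_base X \<B>"
  shows "is_base Y ((`) h ` \<B>)"
  unfolding is_base_def
proof (intro conjI allI impI ballI)
  fix V assume "V \<in> (`) h ` \<B>"
  then show "openin Y V"
    using assms homeomorphic_imp_open_map[OF h] unfolding is_base_def open_map_def by auto
next
  fix U y assume U: "openin Y U \<and> y \<in> U"
  let ?W = "{x \<in> topspace X. h x \<in> U}"
  have W: "openin X ?W"
    using openin_continuous_map_preimage[OF homeomorphic_imp_continuous_map[OF h]] U by auto
  have "y \<in> topspace Y" using U openin_subset by blast
  then obtain x where x: "x \<in> topspace X" "h x = y"
    using homeomorphic_imp_surjective_map[OF h] by (metis imageE)
  then have "x \<in> ?W" using U by auto
  then obtain V where "V \<in> \<B>" "x \<in> V" "V \<subseteq> ?W"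
    using W assms(2) unfolding is_base_def by meson
  then show "\<exists>V\<in>(`) h ` \<B>. y \<in> V \<and> V \<subseteq> U"
    using x by (intro bexI[of _ "h ` V"]) auto
qed

lemma metric_space_code:
  fixes m :: "'k rel" and X :: "'a metric"
  assumes m: "Card_order m" and w: "top_weight (mtopology_of X) \<le>o m"
  shows "\<exists>(X' :: (nat \<Rightarrow> 'k) metric) h. isometric_map X X' h \<and> h ` mspace X = mspace X' \<and>
    top_weight (mtopology_of X') \<le>o m"
proof -
  define M where "M = mspace X"
  define d where "d = mdist X"
  interpret X: Metric_space M d
    unfolding M_def d_def by simp
  have top: "mtopology_of X = X.mtopology"
    by (simp add: mtopology_of_def M_def d_def)
  obtain \<B> where B: "is_base X.mtopology \<B>" "|\<B>| \<le>o m"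
    using top_weight_witness[of X.mtopology] w unfolding top by auto
  define D where "D = (\<lambda>V. SOME x. x \<in> V) ` (\<B> - {{}})"
  have "|D| \<le>o |\<B>|"
    unfolding D_def by (rule ordLeq_transitive[OF card_of_image card_of_mono1]) auto
  then have "|D| \<le>o m"
    using B(2) by (rule ordLeq_transitive)
  then have "|D| \<le>o |Field m|"
    using ordIso_symmetric[OF card_of_Field_ordIso[OF m]] by (rule ordLeq_ordIso_trans)
  then obtain j :: "'a \<Rightarrow> 'k" where j: "inj_on j D"
    using card_of_ordLeq[of D "Field m"] by blast
  have near: "\<exists>a\<in>D. d x a < e" if "x \<in> M" "e > 0" for x e
  proof -
    have "openin X.mtopology (X.mball x e) \<and> x \<in> X.mball x e" using that by auto
    then obtain V where V: "V \<in> \<B>" "x \<in> V" "V \<subseteq> X.mball x e"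
      using B(1) unfolding is_base_def by meson
    have "(SOME x. x \<in> V) \<in> V" using V(2) by (rule someI)
    moreover have "(SOME x. x \<in> V) \<in> D" using V unfolding D_def by blast
    ultimately show ?thesis using V(3) by (intro bexI[of _ "SOME x. x \<in> V"]) auto
  qed
  have DM: "D \<subseteq> M"
  proof
    fix a assume "a \<in> D"
    then obtain V where V: "V \<in> \<B>" "V \<noteq> {}" "a = (SOME x. x \<in> V)" unfolding D_def by blast
    then have "a \<in> V" by (simp add: some_in_eq)
    moreover have "V \<subseteq> M" using V B(1) unfolding is_base_def by (auto dest!: openin_subset bspec)
    ultimately show "a \<in> M" by blast
  qed
  define c where "c x n = (SOME a. a \<in> D \<and> d x a < inverse (real (Suc n)))" for x n
  have c: "c x n \<in> D \<and> d x (c x n) < inverse (real (Suc n))" if "x \<in> M" for x n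
    unfolding c_def
    by (rule someI_ex) (use near[OF that, of "inverse (real (Suc n))"] in \<open>simp add: Bex_def\<close>)
  define h where "h x = (\<lambda>n. j (c x n))" for x
  have inj: "inj_on h M"
  proof (rule inj_onI, rule ccontr)
    fix x y assume xy: "x \<in> M" "y \<in> M" "h x = h y" "x \<noteq> y"
    then have "d x y / 2 > 0" by auto
    then obtain n where n: "inverse (real (Suc n)) < d x y / 2"
      using reals_Archimedean by blast
    have "j (c x n) = j (c y n)" using fun_cong[OF xy(3), of n] by (simp add: h_def)
    then have e: "c x n = c y n"
      by (rule inj_onD[OF j]) (use c[OF xy(1), of n] c[OF xy(2), of n] in auto)
    have "c x n \<in> M" using c[OF xy(1), of n] DM by blast
    from X.triangle[OF xy(1) this xy(2)] have "d x y \<le> d x (c x n) + d y (c x n)"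
      by (simp add: X.commute[of "c x n" y])
    then show False using c[OF xy(1), of n] c[OF xy(2), of n] e n by simp
  qed
  define d' where "d' u v = d (inv_into M h u) (inv_into M h v)" for u v
  have ih: "inv_into M h (h x) = x" if "x \<in> M" for x using inj that by simp
  have MS: "Metric_space (h ` M) d'"
  proof
    fix u v show "0 \<le> d' u v" by (simp add: d'_def)
    show "d' u v = d' v u" by (simp add: d'_def X.commute)
  next
    fix u v assume "u \<in> h ` M" "v \<in> h ` M"
    then show "d' u v = 0 \<longleftrightarrow> u = v" by (auto simp: d'_def ih)
  next
    fix u v w assume "u \<in> h ` M" "v \<in> h ` M" "w \<in> h ` M"
    then show "d' u w \<le> d' u v + d' v w" by (auto simp: d'_def ih intro: X.triangle)
  qed
  interpret X': Metric_space "h ` M" d' by (rule MS)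
  interpret XX: Metric_space12 M d "h ` M" d' ..
  define X' where "X' = metric (h ` M, d')"
  have X': "mspace X' = h ` M" "mdist X' = d'" "mtopology_of X' = X'.mtopology"
    by (simp_all add: X'_def mtopology_of_def)
  have "homeomorphic_map X.mtopology X'.mtopology h"
    by (rule XX.isometry_imp_homeomorphic_map) (auto simp: d'_def ih)
  from weight_transfer[OF this B(1)] have "is_base (mtopology_of X') ((`) h ` \<B>)"
    by (simp add: X')
  then have "top_weight (mtopology_of X') \<le>o |(`) h ` \<B>|"
    by (rule top_weight_le)
  also have "|(`) h ` \<B>| \<le>o |\<B>|" by (rule card_of_image)
  also have "|\<B>| \<le>o m" by (rule B)
  finally have "top_weight (mtopology_of X') \<le>o m" .
  moreover have "isometric_map X X' h"
    unfolding isometric_map_def X' by (auto simp: d'_def ih M_def[symmetric] d_def[symmetric])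
  moreover have "h ` mspace X = mspace X'" by (simp add: X' M_def)
  ultimately show ?thesis by blast
qed

lemma urysohn_katetov_universal:
  fixes m :: "'k rel" and U :: "'u metric" and X :: "'a metric"
  assumes "Card_order m" "urysohn_katetov m U" "top_weight (mtopology_of X) \<le>o m"
  shows "\<exists>f. isometric_map X U f"
proof -
  obtain X' :: "(nat \<Rightarrow> 'k) metric" and h where h: "isometric_map X X' h"
      "top_weight (mtopology_of X') \<le>o m"
    using metric_space_code assms(1,3) by blast
  then obtain f where f: "isometric_map X' U f"
    using assms(2) unfolding urysohn_katetov_def by blast
  have "isometric_map X U (f \<circ> h)"
    using h(1) f by (auto simp: isometric_map_def Pi_iff)
  then show ?thesis by blast
qed

section \<open>Topological groups\<close>

definition topological_group :: "('g, 'b) monoid_scheme \<Rightarrow> 'g topology \<Rightarrow> bool" where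
  "topological_group G T \<longleftrightarrow> group G \<and> topspace T = carrier G \<and>
     continuous_map (prod_topology T T) T (\<lambda>(x, y). x \<otimes>\<^bsub>G\<^esub> y) \<and>
     continuous_map T T (\<lambda>x. inv\<^bsub>G\<^esub> x)"

definition SIN_group :: "('g, 'b) monoid_scheme \<Rightarrow> 'g topology \<Rightarrow> bool" where
  "SIN_group G T \<longleftrightarrow> topological_group G T \<and>
     (\<forall>W. openin T W \<and> \<one>\<^bsub>G\<^esub> \<in> W \<longrightarrow>
       (\<exists>V. openin T V \<and> \<one>\<^bsub>G\<^esub> \<in> V \<and> V \<subseteq> W \<and>
         (\<forall>g\<in>carrier G. \<forall>x\<in>V. g \<otimes>\<^bsub>G\<^esub> x \<otimes>\<^bsub>G\<^esub> inv\<^bsub>G\<^esub> g \<in> V)))"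

definition embeds_topologically ::
  "('g, 'b) monoid_scheme \<Rightarrow> 'g topology \<Rightarrow> ('h, 'c) monoid_scheme \<Rightarrow> 'h topology \<Rightarrow> bool" where
  "embeds_topologically G T K S \<longleftrightarrow>
     (\<exists>H \<phi>. subgroup H K \<and> \<phi> \<in> iso G (K\<lparr>carrier := H\<rparr>) \<and>
        homeomorphic_map T (subtopology S H) \<phi>)"

end

theory Submission
  imports Defs
begin

text \<open>A metrizable SIN group carries a bi-invariant metric \<open>N (x\<^sup>-\<^sup>1 y)\<close>. The left translation by \<open>g\<close>
  is then an isometry that moves every point by exactly \<open>N g\<close>, and such a uniform bound on the
  displacement, unlike pointwise convergence, survives the passage to Katetov functions, unions and
  completions.

  The iterated construction of the Urysohn--Katetov space over the group is replaced by a
  back-and-forth argument with the given space \<open>U\<close>. Along the well-order \<open>m\<close> one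
  builds an invariant pseudometric on \<open>Field m \<times> carrier G\<close>, one \<open>G\<close>-orbit per stage, together with a
  distance-preserving relation into \<open>U\<close>. The new orbit realises the distances of the next point of a
  dense subset of \<open>U\<close>, and the extension property of \<open>U\<close> serves the points of the orbits built so far.
  In the limit \<open>U\<close> is the completion of the pseudometric space, so that \<open>G\<close> acts on \<open>U\<close> with
  displacement at most \<open>N g\<close>, attained on the first orbit, which is a copy of \<open>G\<close>.\<close>

section \<open>Bi-invariant lengths on SIN groups\<close>

text \<open>The space \<open>U\<close> is given only by its defining property, so building inside it
  saves identifying a separately constructed space with it. That property governs configurations of
  fewer than \<open>m\<close> points, while one orbit is a copy of \<open>carrier G\<close>, which
  may have \<open>m\<close> points or more. Hence no orbit is mapped into \<open>U\<close> while the
  recursion runs. Each stage records just two matched pairs, and the Katetov function defining a new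
  orbit is computed from the pairs recorded so far. All other points of the orbits reach
  \<open>U\<close> at the end by completeness, once the matched points are known to be dense among
  them.

  The group is kept on the side of the orbits: the matching is not equivariant, and no action on
  \<open>U\<close> exists before the matching is finished.

  The displacement bound has a further use. On orbits after the first the pseudometric is not known
  explicitly; the bound nevertheless shows that a dense subset of \<open>G\<close> yields a dense
  subset of every orbit, so that few enough points have to be matched.\<close>

lemma list_split_at_threshold:
  fixes w :: "'a \<Rightarrow> real"
  assumes "0 \<le> c" "c < sum_list (map w zs)"
  shows "\<exists>ys z ws. zs = ys @ z # ws \<and> sum_list (map w ys) \<le> c \<and> c < sum_list (map w ys) + w z"
  using assms
proof (induction zs arbitrary: c)
  case Nil
  then show ?case by simp
next
  case (Cons a zs)
  show ?case
  proof (cases "c < w a")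
    case True
    then show ?thesis using Cons.prems by (intro exI[of _ "[]"] exI[of _ a] exI[of _ zs]) simp
  next
    case False
    then obtain ys z ws where "zs = ys @ z # ws" "sum_list (map w ys) \<le> c - w a"
        "c - w a < sum_list (map w ys) + w z"
      using Cons.IH[of "c - w a"] Cons.prems by auto
    then show ?thesis by (intro exI[of _ "a # ys"] exI[of _ z] exI[of _ ws]) simp
  qed
qed

section \<open>Lengths generated by a chain of invariant neighbourhoods\<close>

lemma (in group) inv_cancel_left [simp]:
  assumes "g \<in> carrier G" "x \<in> carrier G"
  shows "inv g \<otimes> (g \<otimes> x) = x" "g \<otimes> (inv g \<otimes> x) = x"
  using assms by (simp_all add: m_assoc[symmetric])

locale group_length = group G for G (structure) +
  fixes N :: "'a \<Rightarrow> real"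
  assumes N_one [simp]: "N \<one> = 0"
    and N_nonneg: "x \<in> carrier G \<Longrightarrow> 0 \<le> N x"
    and N_mult: "x \<in> carrier G \<Longrightarrow> y \<in> carrier G \<Longrightarrow> N (x \<otimes> y) \<le> N x + N y"
    and N_inv: "x \<in> carrier G \<Longrightarrow> N (inv x) = N x"
    and N_conj: "g \<in> carrier G \<Longrightarrow> x \<in> carrier G \<Longrightarrow> N (g \<otimes> x \<otimes> inv g) = N x"
    and N_eq_0: "x \<in> carrier G \<Longrightarrow> N x = 0 \<Longrightarrow> x = \<one>"

text \<open>The chains of the Birkhoff-Kakutani metrization theorem, with conjugation invariance
  added. The triple product matches the splitting of a word into a left part, one letter and a right
  part. Since \<open>V 0\<close> is the whole group, every element is the value of a one-letter
  word.\<close>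

locale SIN_chain = group G for G (structure) +
  fixes V :: "nat \<Rightarrow> 'a set"
  assumes V_0: "V 0 = carrier G"
    and V_one: "\<one> \<in> V n"
    and V_inv: "x \<in> V n \<Longrightarrow> inv x \<in> V n"
    and V_conj: "g \<in> carrier G \<Longrightarrow> x \<in> V n \<Longrightarrow> g \<otimes> x \<otimes> inv g \<in> V n"
    and V_carrier: "V n \<subseteq> carrier G"
    and V_mult3: "x \<in> V (Suc n) \<Longrightarrow> y \<in> V (Suc n) \<Longrightarrow> z \<in> V (Suc n) \<Longrightarrow> x \<otimes> y \<otimes> z \<in> V n"
    and V_separating: "(\<Inter>n. V n) = {\<one>}"
begin

definition valid :: "('a \<times> nat) list \<Rightarrow> bool" where
  "valid zs \<longleftrightarrow> (\<forall>(x, n)\<in>set zs. x \<in> V n)"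

definition cost :: "('a \<times> nat) list \<Rightarrow> real" where
  "cost zs = (\<Sum>z\<leftarrow>zs. 1 / 2 ^ snd z)"

definition value_of :: "('a \<times> nat) list \<Rightarrow> 'a" where
  "value_of zs = foldr (\<lambda>z y. fst z \<otimes> y) zs \<one>"

definition costs :: "'a \<Rightarrow> real set" where
  "costs x = {cost zs | zs. valid zs \<and> value_of zs = x}"

text \<open>Every factorization of \<open>x\<close> competes, a factor taken from \<open>V n\<close>
  being charged 1/2^n. Concatenating words gives subadditivity at once; the work lies in showing
  that the infimum does not collapse.\<close>

definition len :: "'a \<Rightarrow> real" where
  "len x = Inf (costs x)"

lemma Vc: "x \<in> V n \<Longrightarrow> x \<in> carrier G"
  using V_carrier by blast

lemma V_Suc_subset: "V (Suc n) \<subseteq> V n"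
proof
  fix x assume "x \<in> V (Suc n)"
  then have "x \<otimes> \<one> \<otimes> \<one> \<in> V n" using V_one by (intro V_mult3)
  then show "x \<in> V n" using Vc[OF \<open>x \<in> V (Suc n)\<close>] by simp
qed

lemma V_mono: "n \<le> k \<Longrightarrow> V k \<subseteq> V n"
  using V_Suc_subset by (rule lift_Suc_antimono_le)

lemma valid_simps [simp]:
  "valid []" "valid (z # zs) \<longleftrightarrow> fst z \<in> V (snd z) \<and> valid zs"
  "valid (ys @ zs) \<longleftrightarrow> valid ys \<and> valid zs"
  by (auto simp: valid_def)

lemma cost_simps [simp]:
  "cost [] = 0" "cost (z # zs) = 1 / 2 ^ snd z + cost zs" "cost (ys @ zs) = cost ys + cost zs"
  by (auto simp: cost_def)

lemma value_of_simps [simp]: "value_of [] = \<one>" "value_of (z # zs) = fst z \<otimes> value_of zs"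
  by (auto simp: value_of_def)

lemma cost_nonneg: "0 \<le> cost zs"
  by (induction zs) auto

lemma value_of_closed: "valid zs \<Longrightarrow> value_of zs \<in> carrier G"
  by (induction zs) (auto dest: Vc)

lemma value_of_append:
  "valid ys \<Longrightarrow> valid zs \<Longrightarrow> value_of (ys @ zs) = value_of ys \<otimes> value_of zs"
  by (induction ys) (auto simp: value_of_closed m_assoc Vc)

text \<open>Cut the word at the letter where the running cost passes half of the total. Both outer
  parts cost at most half, so they lie in \<open>V (Suc n)\<close> by induction; the letter itself
  costs less than 1/2^n, so its level exceeds \<open>n\<close>. The product of the three pieces is
  then in \<open>V n\<close>.\<close>

lemma value_of_in_V:
  assumes "valid zs" "cost zs < 1 / 2 ^ n"
  shows "value_of zs \<in> V n"
  using assms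
proof (induction "length zs" arbitrary: zs n rule: less_induct)
  case less
  show ?case
  proof (cases "zs = []")
    case True
    then show ?thesis by (simp add: V_one)
  next
    case False
    then obtain a as where "zs = a # as" by (cases zs) auto
    then have pos: "0 < cost zs" using cost_nonneg[of as] by (simp add: add_pos_nonneg)
    obtain ys z ws where zs: "zs = ys @ z # ws" and ys: "cost ys \<le> cost zs / 2"
        and yz: "cost zs / 2 < cost ys + 1 / 2 ^ snd z"
      using list_split_at_threshold[of "cost zs / 2" "\<lambda>z. 1 / 2 ^ snd z" zs] pos
      unfolding cost_def by auto
    have half: "cost zs / 2 < 1 / 2 ^ Suc n" using less.prems(2) by simp
    have tot: "cost zs = cost ys + 1 / 2 ^ snd z + cost ws" by (simp add: zs)
    have v: "valid ys" "valid ws" "fst z \<in> V (snd z)" using less.prems(1) by (auto simp: zs)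
    have "value_of ys \<in> V (Suc n)" "value_of ws \<in> V (Suc n)"
      using less.hyps[of ys "Suc n"] less.hyps[of ws "Suc n"] v ys yz tot half by (auto simp: zs)
    moreover have "fst z \<in> V (Suc n)"
    proof -
      have "1 / 2 ^ snd z < (1 / 2 ^ n :: real)"
        using tot cost_nonneg[of ys] cost_nonneg[of ws] less.prems(2) by linarith
      then have "(2::real) ^ n < 2 ^ snd z" by (simp add: field_simps)
      then have "n < snd z" by simp
      then show ?thesis using v(3) V_mono[of "Suc n" "snd z"] by auto
    qed
    ultimately have "value_of ys \<otimes> fst z \<otimes> value_of ws \<in> V n" by (intro V_mult3)
    then show ?thesis
      using v less.prems(1) by (simp add: zs value_of_append m_assoc value_of_closed Vc)
  qed
qed

lemma bdd_costs: "bdd_below (costs x)"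
  unfolding costs_def by (rule bdd_belowI[of _ 0]) (auto simp: cost_nonneg)

lemma len_le: "x \<in> V n \<Longrightarrow> len x \<le> 1 / 2 ^ n"
  unfolding len_def
  by (rule cInf_lower[OF _ bdd_costs]) (auto simp: costs_def Vc intro!: exI[of _ "[(x, n)]"])

lemma costs_nonempty: "x \<in> carrier G \<Longrightarrow> costs x \<noteq> {}"
  by (auto simp: costs_def V_0 intro!: exI[of _ "[(x, 0)]"])

lemma len_nonneg: "x \<in> carrier G \<Longrightarrow> 0 \<le> len x"
  unfolding len_def
  by (rule cInf_greatest[OF costs_nonempty]) (auto simp: costs_def cost_nonneg)

lemma len_lessD:
  assumes "x \<in> carrier G" "len x < c"
  shows "\<exists>zs. valid zs \<and> value_of zs = x \<and> cost zs < c"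
proof -
  have "\<exists>r\<in>costs x. r < c"
    using assms cInf_lessD[OF costs_nonempty] unfolding len_def by blast
  then show ?thesis unfolding costs_def by blast
qed

lemma in_V_of_len: "x \<in> carrier G \<Longrightarrow> len x < 1 / 2 ^ n \<Longrightarrow> x \<in> V n"
  using len_lessD value_of_in_V by blast

text \<open>Reduces the symmetries of \<open>len\<close> to rewriting words at equal cost: reversal
  with inverted letters for inverses, letterwise conjugation for conjugates.\<close>

lemma len_le_of_costs:
  assumes "x \<in> carrier G" "y \<in> carrier G"
    and *: "\<And>zs. valid zs \<Longrightarrow> value_of zs = x \<Longrightarrow> \<exists>zs'. valid zs' \<and> value_of zs' = y \<and> cost zs' = cost zs"
  shows "len y \<le> len x"
proof -
  have "costs x \<subseteq> costs y"
    unfolding costs_def using * by (smt (verit) Collect_mono)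
  then show ?thesis
    unfolding len_def by (rule cInf_superset_mono[OF costs_nonempty[OF assms(1)] bdd_costs])
qed

lemma len_inv_le:
  assumes "x \<in> carrier G"
  shows "len (inv x) \<le> len x"
proof (rule len_le_of_costs)
  have aux: "valid zs \<Longrightarrow> \<exists>zs'. valid zs' \<and> value_of zs' = inv (value_of zs) \<and> cost zs' = cost zs" for zs
  proof (induction zs)
    case Nil
    show ?case by (rule exI[of _ "[]"]) simp
  next
    case (Cons z zs)
    then obtain zs' where "valid zs'" "value_of zs' = inv (value_of zs)" "cost zs' = cost zs"
      by auto
    with Cons.prems show ?case
      by (intro exI[of _ "zs' @ [(inv (fst z), snd z)]"])
        (auto simp: V_inv value_of_append inv_mult_group value_of_closed Vc)
  qed
  fix zs assume "valid zs" "value_of zs = x"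
  then show "\<exists>zs'. valid zs' \<and> value_of zs' = inv x \<and> cost zs' = cost zs"
    using aux by blast
qed (use assms in auto)

lemma len_conj_le:
  assumes g: "g \<in> carrier G" and "x \<in> carrier G"
  shows "len (g \<otimes> x \<otimes> inv g) \<le> len x"
proof (rule len_le_of_costs)
  have aux: "valid zs \<Longrightarrow> \<exists>zs'. valid zs' \<and> value_of zs' = g \<otimes> value_of zs \<otimes> inv g \<and> cost zs' = cost zs" for zs
  proof (induction zs)
    case Nil
    show ?case by (rule exI[of _ "[]"]) (simp add: g)
  next
    case (Cons z zs)
    then obtain zs' where zs': "valid zs'" "value_of zs' = g \<otimes> value_of zs \<otimes> inv g" "cost zs' = cost zs"
      by auto
    have c: "fst z \<in> carrier G" "value_of zs \<in> carrier G"
      using Cons.prems by (auto simp: Vc value_of_closed)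
    have "g \<otimes> fst z \<otimes> inv g \<otimes> (g \<otimes> value_of zs \<otimes> inv g) = g \<otimes> (fst z \<otimes> value_of zs) \<otimes> inv g"
      using c g by (simp add: m_assoc)
    with zs' Cons.prems g show ?case
      by (intro exI[of _ "(g \<otimes> fst z \<otimes> inv g, snd z) # zs'"]) (auto simp: V_conj)
  qed
  fix zs assume "valid zs" "value_of zs = x"
  then show "\<exists>zs'. valid zs' \<and> value_of zs' = g \<otimes> x \<otimes> inv g \<and> cost zs' = cost zs"
    using aux by blast
qed (use assms in auto)

lemma group_length_len: "group_length G len"
proof
  have "len \<one> \<le> 0"
    unfolding len_def
    by (rule cInf_lower[OF _ bdd_costs]) (auto simp: costs_def intro!: exI[of _ "[]"])
  then show "len \<one> = 0" using len_nonneg[of \<one>] by simp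
next
  fix x assume x: "x \<in> carrier G"
  show "0 \<le> len x" using x by (rule len_nonneg)
  show "len (inv x) = len x"
    using len_inv_le[of x] len_inv_le[of "inv x"] x by simp
next
  fix x y assume xy: "x \<in> carrier G" "y \<in> carrier G"
  show "len (x \<otimes> y) \<le> len x + len y"
  proof (rule field_le_epsilon)
    fix e :: real assume "0 < e"
    then obtain ys zs where "valid ys" "value_of ys = x" "cost ys < len x + e / 2"
        "valid zs" "value_of zs = y" "cost zs < len y + e / 2"
      using len_lessD[OF xy(1), of "len x + e / 2"] len_lessD[OF xy(2), of "len y + e / 2"] by auto
    moreover from this have "len (x \<otimes> y) \<le> cost (ys @ zs)"
      unfolding len_def
      by (intro cInf_lower[OF _ bdd_costs]) (auto simp: costs_def value_of_append intro!: exI[of _ "ys @ zs"])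
    ultimately show "len (x \<otimes> y) \<le> len x + len y + e" by simp
  qed
next
  fix g x assume gx: "g \<in> carrier G" "x \<in> carrier G"
  have "inv g \<otimes> (g \<otimes> x \<otimes> inv g) \<otimes> inv (inv g) = x"
    using gx by (simp add: m_assoc)
  then show "len (g \<otimes> x \<otimes> inv g) = len x"
    using len_conj_le[OF gx] len_conj_le[of "inv g" "g \<otimes> x \<otimes> inv g"] gx by simp
next
  fix x assume x: "x \<in> carrier G" "len x = 0"
  then have "x \<in> V n" for n by (intro in_V_of_len) auto
  then have "x \<in> (\<Inter>n. V n)" by blast
  then show "x = \<one>" using V_separating by blast
qed

end

text \<open>Continuity of multiplication is used twice, so that products of three elements stay in
  \<open>W\<close>. Conjugation invariance comes next and symmetry last: intersecting an invariant
  set with its inverse keeps it invariant, because conjugation commutes with inversion.\<close>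

lemma SIN_group_shrink:
  assumes SIN: "SIN_group G T" and W: "openin T W" "\<one>\<^bsub>G\<^esub> \<in> W"
  shows "\<exists>V. openin T V \<and> \<one>\<^bsub>G\<^esub> \<in> V \<and> V \<subseteq> W \<and>
    (\<forall>x\<in>V. inv\<^bsub>G\<^esub> x \<in> V) \<and>
    (\<forall>g\<in>carrier G. \<forall>x\<in>V. g \<otimes>\<^bsub>G\<^esub> x \<otimes>\<^bsub>G\<^esub> inv\<^bsub>G\<^esub> g \<in> V) \<and>
    (\<forall>x\<in>V. \<forall>y\<in>V. \<forall>z\<in>V. x \<otimes>\<^bsub>G\<^esub> y \<otimes>\<^bsub>G\<^esub> z \<in> W)"
proof -
  have TG: "topological_group G T"
    using SIN unfolding SIN_group_def by (rule conjunct1)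
  have conj: "\<exists>V. openin T V \<and> \<one>\<^bsub>G\<^esub> \<in> V \<and> V \<subseteq> W \<and>
         (\<forall>g\<in>carrier G. \<forall>x\<in>V. g \<otimes>\<^bsub>G\<^esub> x \<otimes>\<^bsub>G\<^esub> inv\<^bsub>G\<^esub> g \<in> V)"
    if "openin T W" "\<one>\<^bsub>G\<^esub> \<in> W" for W
    using SIN that unfolding SIN_group_def by simp
  interpret group G using TG by (simp add: topological_group_def)
  have top: "topspace T = carrier G"
    and mult: "continuous_map (prod_topology T T) T (\<lambda>(x, y). x \<otimes>\<^bsub>G\<^esub> y)"
    and inv: "continuous_map T T (\<lambda>x. inv\<^bsub>G\<^esub> x)"
    using TG by (auto simp: topological_group_def)
  have square: "\<exists>V. openin T V \<and> \<one>\<^bsub>G\<^esub> \<in> V \<and> V \<subseteq> W \<and> (\<forall>x\<in>V. \<forall>y\<in>V. x \<otimes>\<^bsub>G\<^esub> y \<in> W)"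
    if W: "openin T W" "\<one>\<^bsub>G\<^esub> \<in> W" for W
  proof -
    let ?P = "{p \<in> topspace (prod_topology T T). (\<lambda>(x, y). x \<otimes>\<^bsub>G\<^esub> y) p \<in> W}"
    have "openin (prod_topology T T) ?P"
      using mult W(1) by (rule openin_continuous_map_preimage)
    moreover have "(\<one>\<^bsub>G\<^esub>, \<one>\<^bsub>G\<^esub>) \<in> ?P" using W top by simp
    ultimately have "\<exists>A B. openin T A \<and> openin T B \<and> \<one>\<^bsub>G\<^esub> \<in> A \<and> \<one>\<^bsub>G\<^esub> \<in> B \<and> A \<times> B \<subseteq> ?P"
      unfolding openin_prod_topology_alt by (elim allE impE)
    then obtain A B where AB: "openin T A" "openin T B" "\<one>\<^bsub>G\<^esub> \<in> A" "\<one>\<^bsub>G\<^esub> \<in> B" "A \<times> B \<subseteq> ?P"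
      by (elim exE conjE)
    then have "x \<otimes>\<^bsub>G\<^esub> y \<in> W" if "x \<in> A \<inter> B" "y \<in> A \<inter> B" for x y
      using that AB(5) by auto
    then show ?thesis
      using AB(1-4) W by (intro exI[of _ "A \<inter> B \<inter> W"]) auto
  qed
  obtain V1 where V1: "openin T V1" "\<one>\<^bsub>G\<^esub> \<in> V1" "V1 \<subseteq> W" "\<And>x y. x \<in> V1 \<Longrightarrow> y \<in> V1 \<Longrightarrow> x \<otimes>\<^bsub>G\<^esub> y \<in> W"
    using square[OF W] by blast
  obtain V2 where V2: "openin T V2" "\<one>\<^bsub>G\<^esub> \<in> V2" "V2 \<subseteq> V1" "\<And>x y. x \<in> V2 \<Longrightarrow> y \<in> V2 \<Longrightarrow> x \<otimes>\<^bsub>G\<^esub> y \<in> V1"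
    using square[OF V1(1,2)] by blast
  obtain V3 where V3: "openin T V3" "\<one>\<^bsub>G\<^esub> \<in> V3" "V3 \<subseteq> V2"
      "\<And>g x. g \<in> carrier G \<Longrightarrow> x \<in> V3 \<Longrightarrow> g \<otimes>\<^bsub>G\<^esub> x \<otimes>\<^bsub>G\<^esub> inv\<^bsub>G\<^esub> g \<in> V3"
    using conj[OF V2(1,2)] by blast
  have V3c: "V3 \<subseteq> carrier G" using openin_subset[OF V3(1)] top by simp
  define V where "V = V3 \<inter> {x \<in> topspace T. inv\<^bsub>G\<^esub> x \<in> V3}"
  have "openin T V"
    unfolding V_def by (intro openin_Int V3(1) openin_continuous_map_preimage[OF inv V3(1)])
  moreover have "\<one>\<^bsub>G\<^esub> \<in> V" using V3 top by (simp add: V_def)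
  moreover have "V \<subseteq> W" using V1(3) V2(3) V3(3) unfolding V_def by blast
  moreover have "\<forall>x\<in>V. inv\<^bsub>G\<^esub> x \<in> V" using V3c top by (auto simp: V_def)
  moreover have "g \<otimes>\<^bsub>G\<^esub> x \<otimes>\<^bsub>G\<^esub> inv\<^bsub>G\<^esub> g \<in> V" if "g \<in> carrier G" "x \<in> V" for g x
  proof -
    have x: "x \<in> carrier G" "x \<in> V3" "inv\<^bsub>G\<^esub> x \<in> V3" using that V3c by (auto simp: V_def)
    then have "inv\<^bsub>G\<^esub> (g \<otimes>\<^bsub>G\<^esub> x \<otimes>\<^bsub>G\<^esub> inv\<^bsub>G\<^esub> g) = g \<otimes>\<^bsub>G\<^esub> inv\<^bsub>G\<^esub> x \<otimes>\<^bsub>G\<^esub> inv\<^bsub>G\<^esub> g"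
      using that by (simp add: inv_mult_group m_assoc)
    then show ?thesis using V3(4)[OF that(1)] x that(1) top by (simp add: V_def)
  qed
  moreover have "x \<otimes>\<^bsub>G\<^esub> y \<otimes>\<^bsub>G\<^esub> z \<in> W" if "x \<in> V" "y \<in> V" "z \<in> V" for x y z
  proof -
    have "x \<in> V2" "y \<in> V2" "z \<in> V1" using that V3(3) V2(3) by (auto simp: V_def)
    then show ?thesis by (intro V1(4) V2(4))
  qed
  ultimately show ?thesis by (intro exI[of _ V]) simp
qed

text \<open>A metric for \<open>T\<close> supplies a countable neighbourhood base at the identity,
  along which an invariant chain is chosen. The sets of the chain and the balls of the resulting
  length refine each other, and left translations carry this comparison from the identity to every
  point.\<close>

lemma SIN_group_length:
  assumes SIN: "SIN_group G T" and "metrizable_space T"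
  shows "\<exists>N. group_length G N \<and> (\<forall>S. openin T S \<longleftrightarrow>
    S \<subseteq> carrier G \<and> (\<forall>x\<in>S. \<exists>e>0. \<forall>y\<in>carrier G. N (inv\<^bsub>G\<^esub> x \<otimes>\<^bsub>G\<^esub> y) < e \<longrightarrow> y \<in> S))"
proof -
  have TG: "topological_group G T" using SIN by (simp add: SIN_group_def)
  interpret group G using TG by (simp add: topological_group_def)
  have top: "topspace T = carrier G"
    and mult: "continuous_map (prod_topology T T) T (\<lambda>(x, y). x \<otimes>\<^bsub>G\<^esub> y)"
    using TG by (auto simp: topological_group_def)
  obtain M \<delta> where M: "Metric_space M \<delta>" "T = Metric_space.mtopology M \<delta>"
    using assms(2) unfolding metrizable_space_def by blast
  have "M = carrier G" using top M Metric_space.topspace_mtopology by metis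
  then have MS: "Metric_space (carrier G) \<delta>" and T: "T = Metric_space.mtopology (carrier G) \<delta>"
    using M by auto
  interpret M: Metric_space "carrier G" \<delta> by (rule MS)
  have left: "continuous_map T T (\<lambda>y. g \<otimes>\<^bsub>G\<^esub> y)" if "g \<in> carrier G" for g
  proof -
    have "continuous_map T (prod_topology T T) (\<lambda>y. (g, y))"
      using that top by (simp add: continuous_map_pairedI)
    from continuous_map_compose[OF this mult] show ?thesis by (simp add: comp_def)
  qed
  define good where "good V W \<longleftrightarrow> openin T V \<and> \<one>\<^bsub>G\<^esub> \<in> V \<and> V \<subseteq> W \<and>
    (\<forall>x\<in>V. inv\<^bsub>G\<^esub> x \<in> V) \<and>
    (\<forall>g\<in>carrier G. \<forall>x\<in>V. g \<otimes>\<^bsub>G\<^esub> x \<otimes>\<^bsub>G\<^esub> inv\<^bsub>G\<^esub> g \<in> V)" for V W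
  define W where "W n = M.mball \<one>\<^bsub>G\<^esub> (inverse (real (Suc n)))" for n
  \<comment> \<open>The index shift is deliberate: \<open>V 0\<close> must be the whole group, so
    the ball of radius \<open>inverse (real (Suc n))\<close> bounds \<open>V (Suc n)\<close>, not
    \<open>V n\<close>.\<close>
  have "\<exists>V. \<forall>n. (good (V n) (carrier G) \<and> (n = 0 \<longrightarrow> V n = carrier G)) \<and>
      (good (V (Suc n)) (W n) \<and> (\<forall>x\<in>V (Suc n). \<forall>y\<in>V (Suc n). \<forall>z\<in>V (Suc n). x \<otimes>\<^bsub>G\<^esub> y \<otimes>\<^bsub>G\<^esub> z \<in> V n))"
  proof (rule dependent_nat_choice)
    have "openin T (carrier G)" using top openin_topspace by metis
    then show "\<exists>V. good V (carrier G) \<and> ((0::nat) = 0 \<longrightarrow> V = carrier G)"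
      by (auto simp: good_def)
  next
    fix V and n :: nat assume V: "good V (carrier G) \<and> (n = 0 \<longrightarrow> V = carrier G)"
    have "openin T (V \<inter> W n)" "\<one>\<^bsub>G\<^esub> \<in> V \<inter> W n"
      using V by (auto simp: good_def W_def T)
    from SIN_group_shrink[OF SIN this] obtain V' where V': "good V' (V \<inter> W n)"
        "\<forall>x\<in>V'. \<forall>y\<in>V'. \<forall>z\<in>V'. x \<otimes>\<^bsub>G\<^esub> y \<otimes>\<^bsub>G\<^esub> z \<in> V \<inter> W n"
      unfolding good_def by blast
    moreover have "good V' (carrier G)" "good V' (W n)"
      using V' V by (auto simp: good_def)
    ultimately show "\<exists>V'. (good V' (carrier G) \<and> (Suc n = 0 \<longrightarrow> V' = carrier G)) \<and>
        (good V' (W n) \<and> (\<forall>x\<in>V'. \<forall>y\<in>V'. \<forall>z\<in>V'. x \<otimes>\<^bsub>G\<^esub> y \<otimes>\<^bsub>G\<^esub> z \<in> V))"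
      by (intro exI[of _ V']) auto
  qed
  then obtain V where "\<forall>n. (good (V n) (carrier G) \<and> (n = 0 \<longrightarrow> V n = carrier G)) \<and>
      (good (V (Suc n)) (W n) \<and> (\<forall>x\<in>V (Suc n). \<forall>y\<in>V (Suc n). \<forall>z\<in>V (Suc n). x \<otimes>\<^bsub>G\<^esub> y \<otimes>\<^bsub>G\<^esub> z \<in> V n))"
    by (rule exE)
  then have V: "\<And>n. good (V n) (carrier G)" "V 0 = carrier G" "\<And>n. good (V (Suc n)) (W n)"
      "\<And>n x y z. x \<in> V (Suc n) \<Longrightarrow> y \<in> V (Suc n) \<Longrightarrow> z \<in> V (Suc n) \<Longrightarrow> x \<otimes>\<^bsub>G\<^esub> y \<otimes>\<^bsub>G\<^esub> z \<in> V n"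
    by simp_all
  have small: "\<exists>n. V n \<subseteq> S" if S: "openin T S" "\<one>\<^bsub>G\<^esub> \<in> S" for S
  proof -
    obtain r where r: "r > 0" "M.mball \<one>\<^bsub>G\<^esub> r \<subseteq> S"
      using S unfolding T M.openin_mtopology by blast
    then obtain n where "inverse (real (Suc n)) < r" using reals_Archimedean by blast
    then have "W n \<subseteq> M.mball \<one>\<^bsub>G\<^esub> r" unfolding W_def by (intro M.mball_subset_concentric) simp
    moreover have "V (Suc n) \<subseteq> W n" using V(3) by (simp add: good_def)
    ultimately show ?thesis using r(2) by blast
  qed
  interpret C: SIN_chain G V
  proof
    show "(\<Inter>n. V n) = {\<one>\<^bsub>G\<^esub>}"
    proof
      show "{\<one>\<^bsub>G\<^esub>} \<subseteq> (\<Inter>n. V n)" using V(1) by (auto simp: good_def)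
      show "(\<Inter>n. V n) \<subseteq> {\<one>\<^bsub>G\<^esub>}"
      proof (rule subsetI, rule ccontr)
        fix x assume x: "x \<in> (\<Inter>n. V n)" "x \<notin> {\<one>\<^bsub>G\<^esub>}"
        then have "x \<in> carrier G" using V(2) by blast
        then have "openin T (M.mball \<one>\<^bsub>G\<^esub> (\<delta> \<one>\<^bsub>G\<^esub> x))" "\<one>\<^bsub>G\<^esub> \<in> M.mball \<one>\<^bsub>G\<^esub> (\<delta> \<one>\<^bsub>G\<^esub> x)"
          using x by (auto simp: T)
        from small[OF this] obtain n where "V n \<subseteq> M.mball \<one>\<^bsub>G\<^esub> (\<delta> \<one>\<^bsub>G\<^esub> x)" by blast
        moreover have "x \<in> V n" using x by blast
        ultimately have "x \<in> M.mball \<one>\<^bsub>G\<^esub> (\<delta> \<one>\<^bsub>G\<^esub> x)" by blast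
        then show False by simp
      qed
    qed
    show "x \<otimes>\<^bsub>G\<^esub> y \<otimes>\<^bsub>G\<^esub> z \<in> V n"
      if "x \<in> V (Suc n)" "y \<in> V (Suc n)" "z \<in> V (Suc n)" for x y z n
      using V(4) that by blast
  qed (use V(1,2) in \<open>auto simp: good_def\<close>)
  have "openin T S \<longleftrightarrow>
    S \<subseteq> carrier G \<and> (\<forall>x\<in>S. \<exists>e>0. \<forall>y\<in>carrier G. C.len (inv\<^bsub>G\<^esub> x \<otimes>\<^bsub>G\<^esub> y) < e \<longrightarrow> y \<in> S)" (is "_ \<longleftrightarrow> ?R") for S
  proof
    assume S: "openin T S"
    show ?R
    proof (intro conjI ballI)
      show "S \<subseteq> carrier G" using openin_subset[OF S] top by simp
      fix x assume x: "x \<in> S"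
      then have xc: "x \<in> carrier G" using \<open>S \<subseteq> carrier G\<close> by blast
      have "openin T {y \<in> topspace T. x \<otimes>\<^bsub>G\<^esub> y \<in> S}"
        using left[OF xc] S by (rule openin_continuous_map_preimage)
      moreover have "\<one>\<^bsub>G\<^esub> \<in> {y \<in> topspace T. x \<otimes>\<^bsub>G\<^esub> y \<in> S}" using x xc top by simp
      ultimately obtain n where n: "V n \<subseteq> {y \<in> topspace T. x \<otimes>\<^bsub>G\<^esub> y \<in> S}" using small by blast
      show "\<exists>e>0. \<forall>y\<in>carrier G. C.len (inv\<^bsub>G\<^esub> x \<otimes>\<^bsub>G\<^esub> y) < e \<longrightarrow> y \<in> S"
      proof (intro exI[of _ "1 / 2 ^ n"] conjI ballI impI)
        fix y assume y: "y \<in> carrier G" "C.len (inv\<^bsub>G\<^esub> x \<otimes>\<^bsub>G\<^esub> y) < 1 / 2 ^ n"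
        then have "inv\<^bsub>G\<^esub> x \<otimes>\<^bsub>G\<^esub> y \<in> V n" using xc by (intro C.in_V_of_len) auto
        then have "x \<otimes>\<^bsub>G\<^esub> (inv\<^bsub>G\<^esub> x \<otimes>\<^bsub>G\<^esub> y) \<in> S" using n by blast
        then show "y \<in> S" using xc y by simp
      qed simp
    qed
  next
    assume R: ?R
    show "openin T S"
    proof (subst openin_subopen, intro ballI)
      fix x assume x: "x \<in> S"
      then have xc: "x \<in> carrier G" using R by blast
      obtain e where e: "e > 0" "\<And>y. y \<in> carrier G \<Longrightarrow> C.len (inv\<^bsub>G\<^esub> x \<otimes>\<^bsub>G\<^esub> y) < e \<Longrightarrow> y \<in> S"
        using R x by blast
      \<comment> \<open>Membership in \<open>V n\<close> gives only the weak bound \<le> 1/2^n on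
        the length, so strictness has to come from the choice of \<open>n\<close>.\<close>
      obtain n where n: "(1 / 2) ^ n < e" using real_arch_pow_inv[OF e(1), of "1/2"] by auto
      let ?O = "{y \<in> topspace T. inv\<^bsub>G\<^esub> x \<otimes>\<^bsub>G\<^esub> y \<in> V n}"
      have "openin T ?O"
        by (rule openin_continuous_map_preimage[OF left]) (use xc V(1) in \<open>auto simp: good_def\<close>)
      moreover have "x \<in> ?O" using xc top C.V_one by simp
      moreover have "?O \<subseteq> S"
      proof
        fix y assume "y \<in> ?O"
        then have "y \<in> carrier G" "C.len (inv\<^bsub>G\<^esub> x \<otimes>\<^bsub>G\<^esub> y) \<le> 1 / 2 ^ n" using top C.len_le by auto
        then show "y \<in> S" using n by (intro e(2)) (auto simp: power_one_over)
      qed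
      ultimately show "\<exists>O'. openin T O' \<and> x \<in> O' \<and> O' \<subseteq> S" by blast
    qed
  qed
  then show ?thesis using C.group_length_len by blast
qed

lemma (in group_length) openin_length_ball:
  assumes T: "\<And>S. openin T S \<longleftrightarrow> S \<subseteq> carrier G \<and>
      (\<forall>x\<in>S. \<exists>e>0. \<forall>y\<in>carrier G. N (inv x \<otimes> y) < e \<longrightarrow> y \<in> S)"
    and x: "x \<in> carrier G"
  shows "openin T {y \<in> carrier G. N (inv x \<otimes> y) < \<epsilon>}" (is "openin T ?O")
  unfolding T
proof (intro conjI ballI)
  fix y assume y: "y \<in> ?O"
  show "\<exists>e>0. \<forall>z\<in>carrier G. N (inv y \<otimes> z) < e \<longrightarrow> z \<in> ?O"
  proof (intro exI[of _ "\<epsilon> - N (inv x \<otimes> y)"] conjI ballI impI)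
    fix z assume z: "z \<in> carrier G" "N (inv y \<otimes> z) < \<epsilon> - N (inv x \<otimes> y)"
    have "inv x \<otimes> z = (inv x \<otimes> y) \<otimes> (inv y \<otimes> z)" using x y z by (simp add: m_assoc)
    then have "N (inv x \<otimes> z) \<le> N (inv x \<otimes> y) + N (inv y \<otimes> z)"
      using N_mult[of "inv x \<otimes> y" "inv y \<otimes> z"] x y z by simp
    then show "z \<in> ?O" using z by simp
  qed (use y in auto)
qed auto

section \<open>The extension property of the Urysohn--Katetov space\<close>

lemma Card_order_linear:
  assumes "Card_order m"
  shows "a \<in> Field m \<Longrightarrow> (a, a) \<in> m"
    and "(a, b) \<in> m \<Longrightarrow> (b, c) \<in> m \<Longrightarrow> (a, c) \<in> m"
    and "(a, b) \<in> m \<Longrightarrow> (b, a) \<in> m \<Longrightarrow> a = b"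
    and "a \<in> Field m \<Longrightarrow> b \<in> Field m \<Longrightarrow> (a, b) \<in> m \<or> (b, a) \<in> m"
    and "wf (m - Id)"
proof -
  have "Well_order m" using assms by (simp add: card_order_on_well_order_on)
  then have wo: "refl_on (Field m) m" "trans m" "antisym m" "total_on (Field m) m" "wf (m - Id)"
    unfolding order_on_defs by blast+
  show refl: "a \<in> Field m \<Longrightarrow> (a, a) \<in> m" for a using wo(1) by (simp add: refl_on_def)
  show "(a, b) \<in> m \<Longrightarrow> (b, c) \<in> m \<Longrightarrow> (a, c) \<in> m" using wo(2) by (rule transD)
  show "(a, b) \<in> m \<Longrightarrow> (b, a) \<in> m \<Longrightarrow> a = b" using wo(3) by (rule antisymD)
  show "a \<in> Field m \<Longrightarrow> b \<in> Field m \<Longrightarrow> (a, b) \<in> m \<or> (b, a) \<in> m"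
    using wo(4)[unfolded total_on_def] refl[of a] by (cases "a = b") simp_all
  show "wf (m - Id)" by fact
qed

lemma dense_subset_of_weight:
  assumes "top_weight X \<le>o m"
  obtains D where "D \<subseteq> topspace X" and "|D| \<le>o m"
    and "\<And>W. openin X W \<Longrightarrow> W \<noteq> {} \<Longrightarrow> W \<inter> D \<noteq> {}"
proof -
  obtain \<B> where B: "is_base X \<B>" "top_weight X = |\<B>|"
    using top_weight_witness[of X] by blast
  define D where "D = (\<lambda>V. SOME x. x \<in> V) ` (\<B> - {{}})"
  have some: "(SOME x. x \<in> V) \<in> V" if "V \<noteq> {}" for V :: "'a set"
    using that by (simp add: some_in_eq)
  have "|D| \<le>o |\<B>|"
    unfolding D_def by (rule ordLeq_transitive[OF card_of_image card_of_mono1]) auto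
  have "D \<subseteq> topspace X"
  proof
    fix a assume "a \<in> D"
    then obtain V where V: "V \<in> \<B>" "V \<noteq> {}" "a = (SOME x. x \<in> V)" unfolding D_def by blast
    then have "openin X V" using B(1) unfolding is_base_def by blast
    then show "a \<in> topspace X" using some[OF V(2)] V(3) openin_subset by blast
  qed
  moreover have "W \<inter> D \<noteq> {}" if W: "openin X W" "W \<noteq> {}" for W
  proof -
    obtain x where "x \<in> W" using W by blast
    then obtain V where V: "V \<in> \<B>" "x \<in> V" "V \<subseteq> W"
      using B(1) W(1) unfolding is_base_def by meson
    then have "(SOME x. x \<in> V) \<in> D \<inter> V"
      using some[of V] unfolding D_def by blast
    then show ?thesis using V(3) by blast
  qed
  moreover have "|D| \<le>o m"
    using \<open>|D| \<le>o |\<B>|\<close> assms unfolding B(2) by (rule ordLeq_transitive)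
  ultimately show thesis by (intro that[of D])
qed

lemma nat_ordLeq_cinfinite: "Card_order m \<Longrightarrow> cinfinite m \<Longrightarrow> |UNIV :: nat set| \<le>o m"
  using card_of_nat natLeq_ordLeq_cinfinite ordIso_ordLeq_trans by blast

lemma finite_ordLess_cinfinite: "finite A \<Longrightarrow> Card_order m \<Longrightarrow> cinfinite m \<Longrightarrow> |A| <o m"
  by (rule finite_ordLess_infinite)
    (auto simp: cinfinite_def Field_card_of card_of_well_order_on card_order_on_well_order_on)

lemma top_weight_metric_le_card:
  assumes m: "Card_order m" "cinfinite m" and X: "|mspace X| \<le>o m"
  shows "top_weight (mtopology_of X) \<le>o m"
proof -
  interpret X: Metric_space "mspace X" "mdist X" by simp
  define \<B> where "\<B> = (\<lambda>(x, n). X.mball x (inverse (real (Suc n)))) ` (mspace X \<times> UNIV)"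
  have "is_base X.mtopology \<B>"
    unfolding is_base_def
  proof (intro conjI ballI allI impI)
    fix V assume "V \<in> \<B>"
    then show "openin X.mtopology V" unfolding \<B>_def by auto
  next
    fix W x assume Wx: "openin X.mtopology W \<and> x \<in> W"
    then have x: "x \<in> mspace X" using openin_subset by fastforce
    obtain r where r: "r > 0" "X.mball x r \<subseteq> W"
      using Wx unfolding X.openin_mtopology by blast
    then obtain n where n: "inverse (real (Suc n)) < r" using reals_Archimedean by blast
    have "X.mball x (inverse (real (Suc n))) \<subseteq> X.mball x r"
      using n by (intro X.mball_subset_concentric) simp
    moreover have "x \<in> X.mball x (inverse (real (Suc n)))" using x by simp
    moreover have "X.mball x (inverse (real (Suc n))) \<in> \<B>" using x unfolding \<B>_def by auto
    ultimately show "\<exists>V\<in>\<B>. x \<in> V \<and> V \<subseteq> W" using r(2) by blast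
  qed
  then have "top_weight (mtopology_of X) \<le>o |\<B>|"
    unfolding mtopology_of_def by (rule top_weight_le)
  also have "|\<B>| \<le>o |mspace X \<times> (UNIV :: nat set)|"
    unfolding \<B>_def by (rule card_of_image)
  also have "|mspace X \<times> (UNIV :: nat set)| \<le>o m"
    using m X nat_ordLeq_cinfinite[OF m]
    by (intro card_of_Times_ordLeq_infinite_Field) (auto simp: cinfinite_def)
  finally show ?thesis .
qed

text \<open>Adjoin to \<open>S\<close> an abstract point at distances \<open>f\<close>. Universality
  places a copy of the enlarged space somewhere in \<open>U\<close>, and homogeneity moves the copy
  of \<open>S\<close> back onto \<open>S\<close>; the adjoined point is carried along to the
  required \<open>z\<close>.\<close>

lemma urysohn_katetov_extension:
  assumes m: "Card_order m" "cinfinite m" and U: "urysohn_katetov m U"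
    and S: "S \<subseteq> mspace U" "|S| <o m"
    and lip: "\<And>x y. x \<in> S \<Longrightarrow> y \<in> S \<Longrightarrow> f x \<le> f y + mdist U x y"
    and kat: "\<And>x y. x \<in> S \<Longrightarrow> y \<in> S \<Longrightarrow> mdist U x y \<le> f x + f y"
  shows "\<exists>z\<in>mspace U. \<forall>x\<in>S. mdist U z x = f x"
\<comment> \<open>At a zero of \<open>f\<close> the adjoined point would be at distance 0 from a
  point of \<open>S\<close>, violating separation; that point of \<open>S\<close> is itself the
  solution.\<close>
proof (cases "\<exists>s\<in>S. f s = 0")
  case True
  then obtain s where s: "s \<in> S" "f s = 0" by blast
  have "mdist U s x = f x" if "x \<in> S" for x
    using lip[OF that s(1)] kat[OF s(1) that] s(2) mdist_commute[of U s x] by simp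
  then show ?thesis using s(1) S(1) by blast
next
  case False
  interpret U: Metric_space "mspace U" "mdist U" by simp
  have pos: "0 < f x" if "x \<in> S" for x
    using kat[OF that that] S(1) that False by (auto simp: less_le)
  \<comment> \<open>A \<open>Metric_space\<close> distance must be nonnegative on all arguments,
    also outside its carrier; the absolute values secure this where \<open>f\<close> is
    unconstrained.\<close>
  define e where "e p q = (case p of None \<Rightarrow> (case q of None \<Rightarrow> 0 | Some y \<Rightarrow> \<bar>f y\<bar>)
      | Some x \<Rightarrow> (case q of None \<Rightarrow> \<bar>f x\<bar> | Some y \<Rightarrow> mdist U x y))" for p q
  have e: "e None None = 0" "e None (Some x) = \<bar>f x\<bar>" "e (Some x) None = \<bar>f x\<bar>"
      "e (Some x) (Some y) = mdist U x y" for x y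
    by (simp_all add: e_def)
  let ?M = "insert None (Some ` S)"
  have MS: "Metric_space ?M e"
  proof
    fix p q
    show "0 \<le> e p q" by (cases p; cases q) (simp_all add: e)
    show "e p q = e q p" by (cases p; cases q) (simp_all add: e U.commute)
  next
    fix p q assume "p \<in> ?M" "q \<in> ?M"
    then show "e p q = 0 \<longleftrightarrow> p = q"
      using pos S(1) by (cases p; cases q) (auto simp: e subset_iff dest: pos)
  next
    fix p q r assume pqr: "p \<in> ?M" "q \<in> ?M" "r \<in> ?M"
    have tri: "mdist U x z \<le> mdist U x y + mdist U y z" if "x \<in> S" "y \<in> S" "z \<in> S" for x y z
      using that S(1) by (intro U.triangle) auto
    have lip': "f x \<le> mdist U x y + f y" "f x \<le> f y + mdist U y x" if "x \<in> S" "y \<in> S" for x y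
      using lip[OF that] by (simp_all add: U.commute)
    have abs: "\<bar>f x\<bar> = f x" if "x \<in> S" for x using pos[OF that] by simp
    show "e p r \<le> e p q + e q r"
      using pqr by (cases p; cases q; cases r) (auto simp: e abs tri lip' kat)
  qed
  interpret E: Metric_space ?M e by (rule MS)
  define X where "X = metric (?M, e)"
  have X: "mspace X = ?M" "mdist X = e" by (simp_all add: X_def)
  have "|?M| \<le>o m"
  proof -
    have "|Some ` S| <o m" using S(2) card_of_image ordLeq_ordLess_trans by blast
    moreover have "|{None}| <o m"
      using m by (intro finite_ordLess_cinfinite) auto
    ultimately have "|{None} \<union> Some ` S| <o m"
      using m by (intro card_of_Un_ordLess_infinite_Field) (auto simp: cinfinite_def)
    then show ?thesis using ordLess_imp_ordLeq by auto
  qed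
  then have "top_weight (mtopology_of X) \<le>o m"
    using m by (intro top_weight_metric_le_card) (simp_all add: X)
  then obtain j where j: "isometric_map X U j"
    using urysohn_katetov_universal[OF m(1) U] by blast
  then have jm: "j p \<in> mspace U" if "p \<in> ?M" for p
    using that unfolding isometric_map_def X by auto
  have jd: "mdist U (j p) (j q) = e p q" if "p \<in> ?M" "q \<in> ?M" for p q
    using j that unfolding isometric_map_def X by auto
  define A where "A = (\<lambda>x. j (Some x)) ` S"
  have inj: "inj_on (\<lambda>x. j (Some x)) S"
  proof (rule inj_onI)
    fix x y assume "x \<in> S" "y \<in> S" "j (Some x) = j (Some y)"
    then show "x = y" using jd[of "Some x" "Some y"] jm[of "Some y"] S(1) by (auto simp: e subset_iff)
  qed
  define h where "h = inv_into S (\<lambda>x. j (Some x))"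
  have h: "h (j (Some x)) = x" if "x \<in> S" for x
    unfolding h_def using inv_into_f_f[OF inj that] .
  have A: "A \<subseteq> mspace U" using jm unfolding A_def by blast
  have density: "top_density (mtopology_of (submetric U B)) <o m" if "B \<subseteq> mspace U" "|B| <o m" for B
  proof -
    let ?T = "mtopology_of (submetric U B)"
    have B: "topspace ?T = B" using that(1) by auto
    have "top_density ?T \<le>o |B|"
      using top_density_witness[of ?T] unfolding B
      by (metis B closure_of_topspace order_refl)
    then show ?thesis using that(2) by (rule ordLeq_ordLess_trans)
  qed
  have "|A| <o m" unfolding A_def using S(2) card_of_image ordLeq_ordLess_trans by blast
  moreover have "isometric_map (submetric U A) (submetric U S) h"
    unfolding isometric_map_def using A S(1) jd by (auto simp: A_def h e Int_absorb2)
  moreover have "h ` A = S" unfolding A_def by (force simp: h)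
  ultimately have hyp: "A \<subseteq> mspace U \<and> S \<subseteq> mspace U \<and>
      top_density (mtopology_of (submetric U A)) <o m \<and>
      top_density (mtopology_of (submetric U S)) <o m \<and>
      isometric_map (submetric U A) (submetric U S) h \<and> h ` A = S"
    using density A S by simp
  from U have "\<forall>A B f. A \<subseteq> mspace U \<and> B \<subseteq> mspace U \<and>
        top_density (mtopology_of (submetric U A)) <o m \<and>
        top_density (mtopology_of (submetric U B)) <o m \<and>
        isometric_map (submetric U A) (submetric U B) f \<and> f ` A = B \<longrightarrow>
        (\<exists>g\<in>carrier (isometry_group U). \<forall>x\<in>A. g x = f x)"
    unfolding urysohn_katetov_def by simp
  from this[THEN spec, THEN spec, THEN spec, THEN mp, OF hyp]
  obtain g where g: "g \<in> carrier (isometry_group U)" "\<forall>x\<in>A. g x = h x"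
    by blast
  have gi: "isometric_map U U g" using g(1) unfolding isometry_group_def by simp
  show ?thesis
  proof (intro bexI ballI)
    show "g (j None) \<in> mspace U" using gi jm by (auto simp: isometric_map_def)
    fix x assume x: "x \<in> S"
    have "g (j (Some x)) = x" using g(2) h x unfolding A_def by auto
    then have "mdist U (g (j None)) x = mdist U (j None) (j (Some x))"
      using gi jm[of None] jm[of "Some x"] x unfolding isometric_map_def by (metis insertCI imageI)
    then show "mdist U (g (j None)) x = f x" using jd[of None "Some x"] x pos[OF x] by (simp add: e)
  qed
qed

section \<open>Adding an orbit\<close>

text \<open>Separation is not demanded: a Katetov function may vanish, so that a new orbit meets an
  old one, and distinct group elements may give points at distance 0. Such points are identified
  only on passing to \<open>U\<close>.\<close>

definition pseudometric_on :: "'x set \<Rightarrow> ('x \<Rightarrow> 'x \<Rightarrow> real) \<Rightarrow> bool" where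
  "pseudometric_on X D \<longleftrightarrow> (\<forall>x\<in>X. D x x = 0) \<and> (\<forall>x\<in>X. \<forall>y\<in>X. D x y = D y x) \<and>
     (\<forall>x\<in>X. \<forall>y\<in>X. \<forall>z\<in>X. D x z \<le> D x y + D y z)"

definition katetov_on :: "'x set \<Rightarrow> ('x \<Rightarrow> 'x \<Rightarrow> real) \<Rightarrow> ('x \<Rightarrow> real) \<Rightarrow> bool" where
  "katetov_on X D f \<longleftrightarrow> (\<forall>x\<in>X. \<forall>y\<in>X. f x \<le> f y + D x y \<and> D x y \<le> f x + f y)"

definition sup_dist :: "'x set \<Rightarrow> ('x \<Rightarrow> real) \<Rightarrow> ('x \<Rightarrow> real) \<Rightarrow> real" where
  "sup_dist X f g = (SUP x\<in>X. \<bar>f x - g x\<bar>)"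

section \<open>Katetov functions on a pseudometric space and their supremum distance\<close>

lemma pseudometric_on_D:
  assumes "pseudometric_on X D"
  shows "x \<in> X \<Longrightarrow> D x x = 0" "x \<in> X \<Longrightarrow> y \<in> X \<Longrightarrow> D x y = D y x"
    "x \<in> X \<Longrightarrow> y \<in> X \<Longrightarrow> z \<in> X \<Longrightarrow> D x z \<le> D x y + D y z"
  using assms unfolding pseudometric_on_def by auto

lemma pseudometric_on_nonneg:
  assumes "pseudometric_on X D" "x \<in> X" "y \<in> X"
  shows "0 \<le> D x y"
  using pseudometric_on_D[OF assms(1)] assms(2,3) by (smt (verit))

lemma katetov_on_D:
  assumes "katetov_on X D f" "x \<in> X" "y \<in> X"
  shows "f x \<le> f y + D x y" "D x y \<le> f x + f y"
  using assms unfolding katetov_on_def by auto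

lemma katetov_on_dist:
  assumes "pseudometric_on X D" "y \<in> X"
  shows "katetov_on X D (D y)"
  using pseudometric_on_D[OF assms(1)] assms(2) unfolding katetov_on_def by (smt (verit))

lemma sup_dist_least: "X \<noteq> {} \<Longrightarrow> (\<And>x. x \<in> X \<Longrightarrow> \<bar>f x - g x\<bar> \<le> c) \<Longrightarrow> sup_dist X f g \<le> c"
  unfolding sup_dist_def by (rule cSUP_least)

lemma sup_dist_upper:
  assumes D: "pseudometric_on X D" and f: "katetov_on X D f" and g: "katetov_on X D g" and x: "x \<in> X"
  shows "\<bar>f x - g x\<bar> \<le> sup_dist X f g"
  unfolding sup_dist_def
proof (rule cSUP_upper[OF x bdd_aboveI2])
  fix y assume y: "y \<in> X"
  \<comment> \<open>Two Katetov functions have bounded difference, even on an unbounded space: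
    compare \<open>f y\<close> \<le> \<open>f x + D x y\<close> with \<open>D x y\<close> \<le>
    \<open>g x + g y\<close>, and conversely.\<close>
  show "\<bar>f y - g y\<bar> \<le> f x + g x"
    using katetov_on_D[OF f x y] katetov_on_D[OF g x y] katetov_on_D[OF f y x] katetov_on_D[OF g y x]
      pseudometric_on_D(2)[OF D x y] by linarith
qed

lemma sup_dist_commute: "sup_dist X f g = sup_dist X g f"
  unfolding sup_dist_def by (simp add: abs_minus_commute)

lemma sup_dist_self: "X \<noteq> {} \<Longrightarrow> sup_dist X f f = 0"
  unfolding sup_dist_def by simp

lemma sup_dist_triangle:
  assumes D: "pseudometric_on X D" and "X \<noteq> {}"
    and "katetov_on X D f" "katetov_on X D g" "katetov_on X D h"
  shows "sup_dist X f h \<le> sup_dist X f g + sup_dist X g h"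
proof (rule sup_dist_least)
  fix x assume "x \<in> X"
  then show "\<bar>f x - h x\<bar> \<le> sup_dist X f g + sup_dist X g h"
    using sup_dist_upper[OF D assms(3,4)] sup_dist_upper[OF D assms(4,5)] by (smt (verit))
qed fact

text \<open>The supremum is attained at \<open>y\<close>. Thus \<open>y\<close> may be identified
  with \<open>D y\<close>, and then \<open>f\<close>, as a point of the function space, realises the
  distances that it prescribes. With a distance function for \<open>f\<close> this is the isometric
  embedding of the space into its Katetov functions.\<close>

lemma sup_dist_dist:
  assumes D: "pseudometric_on X D" and f: "katetov_on X D f" and y: "y \<in> X"
  shows "sup_dist X (D y) f = f y"
proof (rule antisym)
  show "sup_dist X (D y) f \<le> f y"
  proof (rule sup_dist_least)
    fix x assume x: "x \<in> X"
    then show "\<bar>D y x - f x\<bar> \<le> f y"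
      using katetov_on_D[OF f x y] katetov_on_D[OF f y x] pseudometric_on_D(2)[OF D x y] by linarith
  qed (use y in auto)
  have "\<bar>D y y - f y\<bar> \<le> sup_dist X (D y) f"
    by (rule sup_dist_upper[OF D katetov_on_dist[OF D y] f y])
  then show "f y \<le> sup_dist X (D y) f"
    using pseudometric_on_D(1)[OF D y] by simp
qed

section \<open>Invariant pseudometrics of bounded displacement on families of orbits\<close>

context group_length
begin

definition act :: "'a \<Rightarrow> 'i \<times> 'a \<Rightarrow> 'i \<times> 'a" where
  "act g x = (fst x, g \<otimes> snd x)"

definition orbits_pseudometric :: "'i set \<Rightarrow> ('i \<times> 'a \<Rightarrow> 'i \<times> 'a \<Rightarrow> real) \<Rightarrow> bool" where
  "orbits_pseudometric I D \<longleftrightarrow> pseudometric_on (I \<times> carrier G) D \<and>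
     (\<forall>g\<in>carrier G. \<forall>x\<in>I \<times> carrier G. \<forall>y\<in>I \<times> carrier G. D (act g x) (act g y) = D x y) \<and>
     (\<forall>g\<in>carrier G. \<forall>x\<in>I \<times> carrier G. D (act g x) x \<le> N g)"

lemma orbits_pseudometric_D:
  assumes "orbits_pseudometric I D"
  shows "pseudometric_on (I \<times> carrier G) D"
    "g \<in> carrier G \<Longrightarrow> x \<in> I \<times> carrier G \<Longrightarrow> y \<in> I \<times> carrier G \<Longrightarrow> D (act g x) (act g y) = D x y"
    "g \<in> carrier G \<Longrightarrow> x \<in> I \<times> carrier G \<Longrightarrow> D (act g x) x \<le> N g"
  using assms unfolding orbits_pseudometric_def by auto

lemma act_closed [simp]:
  "g \<in> carrier G \<Longrightarrow> x \<in> I \<times> carrier G \<Longrightarrow> act g x \<in> I \<times> carrier G"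
  by (auto simp: act_def)

lemma act_one [simp]: "x \<in> I \<times> carrier G \<Longrightarrow> act \<one> x = x"
  by (auto simp: act_def)

lemma act_mult:
  "g \<in> carrier G \<Longrightarrow> h \<in> carrier G \<Longrightarrow> x \<in> I \<times> carrier G \<Longrightarrow> act (g \<otimes> h) x = act g (act h x)"
  by (auto simp: act_def m_assoc)

text \<open>Left invariance alone makes translations isometries. The displacement of
  \<open>x\<close> under \<open>g\<close> is the length of a conjugate of \<open>inv g\<close> by
  \<open>inv (snd x)\<close>; only conjugation invariance makes it independent of \<open>x\<close>,
  and this is where SIN enters.\<close>

lemma orbits_pseudometric_singleton:
  "orbits_pseudometric {a} (\<lambda>x y. N (inv (snd x) \<otimes> snd y))"
  unfolding orbits_pseudometric_def pseudometric_on_def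
proof (intro conjI ballI)
  fix x y z assume "x \<in> {a} \<times> carrier G" "y \<in> {a} \<times> carrier G" "z \<in> {a} \<times> carrier G"
  then have c: "snd x \<in> carrier G" "snd y \<in> carrier G" "snd z \<in> carrier G" by auto
  show "N (inv (snd x) \<otimes> snd x) = 0" using c by simp
  show "N (inv (snd x) \<otimes> snd y) = N (inv (snd y) \<otimes> snd x)"
    using N_inv[of "inv (snd x) \<otimes> snd y"] c by (simp add: inv_mult_group)
  have "inv (snd x) \<otimes> snd z = (inv (snd x) \<otimes> snd y) \<otimes> (inv (snd y) \<otimes> snd z)"
    using c by (simp add: m_assoc)
  then show "N (inv (snd x) \<otimes> snd z) \<le> N (inv (snd x) \<otimes> snd y) + N (inv (snd y) \<otimes> snd z)"
    using N_mult c by simp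
next
  fix g x y assume "g \<in> carrier G" "x \<in> {a} \<times> carrier G" "y \<in> {a} \<times> carrier G"
  then show "N (inv (snd (act g x)) \<otimes> snd (act g y)) = N (inv (snd x) \<otimes> snd y)"
    by (auto simp: act_def inv_mult_group m_assoc)
next
  fix g x assume g: "g \<in> carrier G" and "x \<in> {a} \<times> carrier G"
  then have x: "snd x \<in> carrier G" by auto
  have "inv (g \<otimes> snd x) \<otimes> snd x = inv (snd x) \<otimes> inv g \<otimes> inv (inv (snd x))"
    using g x by (simp add: inv_mult_group)
  also have "N \<dots> = N (inv g)" using g x by (intro N_conj) auto
  finally show "N (inv (snd (act g x)) \<otimes> snd x) \<le> N g"
    using g by (simp add: act_def N_inv)
qed

text \<open>The new orbit consists of the translates of the Katetov function \<open>f\<close>, at their supremum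
  distance. The displacement bound survives because \<open>f\<close> is 1-Lipschitz.\<close>

lemma orbits_pseudometric_extend:
  assumes O: "orbits_pseudometric I D" and "I \<noteq> {}" and a: "a \<notin> I"
    and f: "katetov_on (I \<times> carrier G) D f"
  shows "\<exists>D'. orbits_pseudometric (insert a I) D' \<and>
    (\<forall>x\<in>I \<times> carrier G. \<forall>y\<in>I \<times> carrier G. D' x y = D x y) \<and>
    (\<forall>x\<in>I \<times> carrier G. D' (a, \<one>) x = f x)"
proof -
  let ?X = "I \<times> carrier G" and ?Y = "insert a I \<times> carrier G"
  note D = orbits_pseudometric_D(1)[OF O]
  note inv = orbits_pseudometric_D(2)[OF O] and disp = orbits_pseudometric_D(3)[OF O]
  have ne: "?X \<noteq> {}" using \<open>I \<noteq> {}\<close> by auto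
  \<comment> \<open>Old and new points alike become Katetov functions on the old space: distance
    functions for the former, translates of \<open>f\<close> for the latter. One supremum distance
    then serves all pairs, and the triangle inequality needs no case distinction.\<close>
  define \<phi> where "\<phi> p = (if fst p = a then (\<lambda>x. f (act (inv (snd p)) x)) else D p)" for p
  have \<phi>_old: "\<phi> p = D p" if "p \<in> ?X" for p
    using that a by (auto simp: \<phi>_def)
  have kat: "katetov_on ?X D (\<phi> p)" if p: "p \<in> ?Y" for p
  proof (cases "fst p = a")
    case False
    then show ?thesis using p katetov_on_dist[OF D, of p] by (auto simp: \<phi>_def)
  next
    case True
    have g: "inv (snd p) \<in> carrier G" using p by auto
    show ?thesis
      unfolding katetov_on_def
    proof (intro ballI)
      fix x y assume xy: "x \<in> ?X" "y \<in> ?X"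
      note katetov_on_D[OF f act_closed[OF g xy(1)] act_closed[OF g xy(2)]]
      then show "\<phi> p x \<le> \<phi> p y + D x y \<and> D x y \<le> \<phi> p x + \<phi> p y"
        using inv[OF g xy] True by (simp add: \<phi>_def)
    qed
  qed
  \<comment> \<open>Equivariance: translating a point only permutes the arguments over which the
    supremum runs, so \<open>D'\<close> will be invariant.\<close>
  have \<phi>_act: "\<phi> (act g p) x = \<phi> p (act (inv g) x)" if gpx: "g \<in> carrier G" "p \<in> ?Y" "x \<in> ?X" for g p x
  proof (cases "fst p = a")
    case True
    have "act (inv (g \<otimes> snd p)) x = act (inv (snd p)) (act (inv g) x)"
      using gpx act_mult[of "inv (snd p)" "inv g" x I] by (auto simp: inv_mult_group)
    then show ?thesis using True by (simp add: \<phi>_def act_def)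
  next
    case False
    then have p: "p \<in> ?X" using gpx by auto
    have "act g (act (inv g) x) = x"
      using gpx act_mult[of g "inv g" x I] by simp
    then have "D (act g p) x = D p (act (inv g) x)"
      using inv[OF gpx(1) p act_closed[of "inv g" x I]] gpx by simp
    then show ?thesis using p gpx by (simp add: \<phi>_old)
  qed
  define D' where "D' p q = sup_dist ?X (\<phi> p) (\<phi> q)" for p q
  have le: "D' (act g p) (act g q) \<le> D' p q" if "g \<in> carrier G" "p \<in> ?Y" "q \<in> ?Y" for g p q
    unfolding D'_def
  proof (rule sup_dist_least[OF ne])
    fix x assume "x \<in> ?X"
    then show "\<bar>\<phi> (act g p) x - \<phi> (act g q) x\<bar> \<le> sup_dist ?X (\<phi> p) (\<phi> q)"
      using that sup_dist_upper[OF D kat kat, of p q "act (inv g) x"] by (simp add: \<phi>_act)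
  qed
  have "orbits_pseudometric (insert a I) D'"
    unfolding orbits_pseudometric_def pseudometric_on_def
  proof (intro conjI ballI)
    fix x y z assume "x \<in> ?Y" "y \<in> ?Y" "z \<in> ?Y"
    then show "D' x x = 0" "D' x y = D' y x" "D' x z \<le> D' x y + D' y z"
      unfolding D'_def using ne
      by (auto intro: sup_dist_self sup_dist_commute sup_dist_triangle[OF D] kat)
  next
    fix g x y assume gxy: "g \<in> carrier G" "x \<in> ?Y" "y \<in> ?Y"
    have "act (inv g) (act g z) = z" if "z \<in> ?Y" for z
      using gxy(1) that act_mult[of "inv g" g z "insert a I"] by simp
    then have "D' x y \<le> D' (act g x) (act g y)"
      using le[of "inv g" "act g x" "act g y"] gxy by simp
    then show "D' (act g x) (act g y) = D' x y" using le[OF gxy] by simp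
  next
    fix g p assume gp: "g \<in> carrier G" "p \<in> ?Y"
    show "D' (act g p) p \<le> N g"
      unfolding D'_def
    proof (rule sup_dist_least[OF ne])
      fix x assume x: "x \<in> ?X"
      have x': "act (inv g) x \<in> ?X" using gp(1) x by simp
      have "D (act (inv g) x) x \<le> N g" "D x (act (inv g) x) \<le> N g"
        using disp[of "inv g" x] x gp(1) N_inv pseudometric_on_D(2)[OF D x x'] by auto
      then show "\<bar>\<phi> (act g p) x - \<phi> p x\<bar> \<le> N g"
        using katetov_on_D(1)[OF kat[OF gp(2)] x x'] katetov_on_D(1)[OF kat[OF gp(2)] x' x]
          \<phi>_act[OF gp x] by linarith
    qed
  qed
  moreover have "D' x y = D x y" if "x \<in> ?X" "y \<in> ?X" for x y
    using that sup_dist_dist[OF D katetov_on_dist[OF D that(2)] that(1)] pseudometric_on_D(2)[OF D that]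
    by (simp add: D'_def \<phi>_old)
  moreover have "D' (a, \<one>) x = f x" if "x \<in> ?X" for x
  proof -
    have "sup_dist ?X (D x) (\<phi> (a, \<one>)) = \<phi> (a, \<one>) x"
      using that by (intro sup_dist_dist[OF D] kat) auto
    moreover have "\<phi> (a, \<one>) x = f x" using that by (simp add: \<phi>_def)
    ultimately show ?thesis using that by (simp add: D'_def \<phi>_old sup_dist_commute)
  qed
  ultimately show ?thesis by blast
qed

end

section \<open>Back and forth\<close>

text \<open>A relation rather than a map, since several points at \<open>D\<close>-distance 0 may
  share one partner in \<open>U\<close>. When \<open>d\<close> is a metric, the condition itself
  forces partners of the same point to coincide.\<close>

definition distance_preserving :: "('x \<Rightarrow> 'x \<Rightarrow> real) \<Rightarrow> ('y \<Rightarrow> 'y \<Rightarrow> real) \<Rightarrow> ('x \<times> 'y) set \<Rightarrow> bool" where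
  "distance_preserving D d R \<longleftrightarrow> (\<forall>(s, s')\<in>R. \<forall>(t, t')\<in>R. D s t = d s' t')"

lemma distance_preservingD:
  "distance_preserving D d R \<Longrightarrow> (s, s') \<in> R \<Longrightarrow> (t, t') \<in> R \<Longrightarrow> D s t = d s' t'"
  unfolding distance_preserving_def by blast

lemma distance_preserving_insert:
  assumes D: "pseudometric_on X D" and d: "pseudometric_on Y d" and R: "R \<subseteq> X \<times> Y"
    and p: "distance_preserving D d R" and xz: "x \<in> X" "z \<in> Y"
    and eq: "\<And>s s'. (s, s') \<in> R \<Longrightarrow> D x s = d z s'"
  shows "distance_preserving D d (insert (x, z) R)"
proof -
  have "D s x = d s' z" if "(s, s') \<in> R" for s s'
    using eq[OF that] pseudometric_on_D(2)[OF D, of x s] pseudometric_on_D(2)[OF d, of z s'] that R xz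
    by auto
  moreover have "D x x = d z z" using pseudometric_on_D(1)[OF D] pseudometric_on_D(1)[OF d] xz by simp
  ultimately show ?thesis
    using p eq unfolding distance_preserving_def by auto
qed

lemma katetov_on_amalgam:
  assumes D: "pseudometric_on X D" and d: "pseudometric_on Y d" and R: "R \<subseteq> X \<times> Y" "R \<noteq> {}"
    and p: "distance_preserving D d R" and v: "v \<in> Y"
  shows "\<exists>f. katetov_on X D f \<and> (\<forall>(s, s')\<in>R. f s = d v s')"
proof -
  define f where "f x = (INF (s, s')\<in>R. d v s' + D s x)" for x
  have bdd: "bdd_below ((\<lambda>(s, s'). d v s' + D s x) ` R)" if "x \<in> X" for x
    using that R v pseudometric_on_nonneg[OF D] pseudometric_on_nonneg[OF d]
    by (intro bdd_belowI2[of _ 0]) (auto intro!: add_nonneg_nonneg)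
  have upper: "f x \<le> d v s' + D s x" if "(s, s') \<in> R" "x \<in> X" for s s' x
    unfolding f_def using cINF_lower[OF bdd[OF that(2)] that(1)] by simp
  have least: "c \<le> f x" if "\<And>s s'. (s, s') \<in> R \<Longrightarrow> c \<le> d v s' + D s x" for c x
    unfolding f_def by (rule cINF_greatest[OF R(2)]) (use that in auto)
  have lip: "f x \<le> f y + D x y" if xy: "x \<in> X" "y \<in> X" for x y
  proof -
    have "f x - D x y \<le> f y"
    proof (rule least)
      fix s s' assume s: "(s, s') \<in> R"
      then have "s \<in> X" using R by auto
      then show "f x - D x y \<le> d v s' + D s y"
        using upper[OF s xy(1)] pseudometric_on_D(3)[OF D _ xy(2,1), of s] pseudometric_on_D(2)[OF D xy]
        by simp
    qed
    then show ?thesis by simp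
  qed
  have kat: "D x y \<le> f x + f y" if xy: "x \<in> X" "y \<in> X" for x y
  proof -
    have "D x y - f y \<le> f x"
    proof (rule least)
      fix s s' assume s: "(s, s') \<in> R"
      have "D x y - (d v s' + D s x) \<le> f y"
      proof (rule least)
        fix t t' assume t: "(t, t') \<in> R"
        have X: "s \<in> X" "t \<in> X" "s' \<in> Y" "t' \<in> Y" using s t R by auto
        have "D x y \<le> D x s + D s y" "D s y \<le> D s t + D t y" "D x s = D s x"
          using pseudometric_on_D(3)[OF D xy(1) X(1) xy(2)] pseudometric_on_D(3)[OF D X(1,2) xy(2)]
            pseudometric_on_D(2)[OF D xy(1) X(1)] by auto
        moreover have "D s t \<le> d v s' + d v t'"
          using distance_preservingD[OF p s t] pseudometric_on_D(3)[OF d X(3) v X(4)]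
            pseudometric_on_D(2)[OF d X(3) v] by simp
        ultimately show "D x y - (d v s' + D s x) \<le> d v t' + D t y" by linarith
      qed
      then show "D x y - f y \<le> d v s' + D s x" by simp
    qed
    then show ?thesis by simp
  qed
  have eq: "f s = d v s'" if s: "(s, s') \<in> R" for s s'
  proof (rule antisym)
    have X: "s \<in> X" "s' \<in> Y" using s R by auto
    show "f s \<le> d v s'" using upper[OF s X(1)] pseudometric_on_D(1)[OF D X(1)] by simp
    show "d v s' \<le> f s"
    proof (rule least)
      fix t t' assume t: "(t, t') \<in> R"
      then have "t' \<in> Y" using R by auto
      then show "d v s' \<le> d v t' + D t s"
        using distance_preservingD[OF p t s] pseudometric_on_D(3)[OF d v _ X(2), of t'] by simp
    qed
  qed
  have "katetov_on X D f" unfolding katetov_on_def using lip kat by blast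
  then show ?thesis using eq by (intro exI[of _ f]) auto
qed

text \<open>The opposite direction needs no infimum, as the extension property prescribes distances
  to matched points only. The choice of a partner is harmless: two partners of the same point are at
  \<open>D\<close>-distance 0.\<close>

lemma katetov_on_transfer:
  assumes D: "pseudometric_on X D" and R: "R \<subseteq> X \<times> Y"
    and p: "distance_preserving D d R" and x: "x \<in> X"
  shows "\<exists>f. katetov_on (snd ` R) d f \<and> (\<forall>(s, s')\<in>R. f s' = D x s)"
proof -
  define f where "f w = D x (SOME s. (s, w) \<in> R)" for w
  have eq: "f s' = D x s" if s: "(s, s') \<in> R" for s s'
  proof -
    define t where "t = (SOME t. (t, s') \<in> R)"
    have t: "(t, s') \<in> R" unfolding t_def using s by (rule someI)
    have X: "s \<in> X" "t \<in> X" using s t R by auto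
    have "D s t = 0" using distance_preservingD[OF p s t] distance_preservingD[OF p s s]
        pseudometric_on_D(1)[OF D X(1)] by simp
    then have "D x s = D x t"
      using pseudometric_on_D(3)[OF D x X] pseudometric_on_D(3)[OF D x X(2,1)] pseudometric_on_D(2)[OF D X]
      by simp
    then show ?thesis unfolding f_def t_def by simp
  qed
  have "katetov_on (snd ` R) d f"
    unfolding katetov_on_def
  proof (intro ballI)
    fix v w assume "v \<in> snd ` R" "w \<in> snd ` R"
    then obtain s t where st: "(s, v) \<in> R" "(t, w) \<in> R" by auto
    then have X: "s \<in> X" "t \<in> X" using R by auto
    show "f v \<le> f w + d v w \<and> d v w \<le> f v + f w"
      using katetov_on_D[OF katetov_on_dist[OF D x] X] distance_preservingD[OF p st] eq[OF st(1)] eq[OF st(2)]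
      by simp
  qed
  then show ?thesis using eq by (intro exI[of _ f]) auto
qed

lemma pseudometric_on_mdist: "pseudometric_on (mspace U) (mdist U)"
proof -
  interpret Metric_space "mspace U" "mdist U" by simp
  show ?thesis unfolding pseudometric_on_def using commute triangle by auto
qed

text \<open>Here \<open>u\<close> lists the points of \<open>U\<close> to be caught and
  \<open>e\<close> the orbit points to be matched. The index of \<open>e a\<close> is at most
  \<open>a\<close>, so the point exists when its turn comes. Density of either list matters only
  outside this locale.\<close>

locale back_and_forth = group_length G N for G (structure) and N +
  fixes m :: "'k rel" and U :: "'u metric" and u :: "'k \<Rightarrow> 'u" and e :: "'k \<Rightarrow> 'k \<times> 'a"
  assumes Card_m: "Card_order m" and cinf: "cinfinite m"
    and extension: "S \<subseteq> mspace U \<Longrightarrow> |S| <o m \<Longrightarrow> katetov_on S (mdist U) f \<Longrightarrow>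
      \<exists>z\<in>mspace U. \<forall>x\<in>S. mdist U z x = f x"
    and u_in: "a \<in> Field m \<Longrightarrow> u a \<in> mspace U"
    and e_in: "a \<in> Field m \<Longrightarrow> e a \<in> under m a \<times> carrier G"
begin

text \<open>The "back" pairs are fixed in advance by \<open>u\<close>; only the partners of the
  points \<open>e b\<close> are produced by the recursion, as second components of
  \<open>f\<close>.\<close>

definition matched :: "('k \<Rightarrow> 'z \<times> 'u) \<Rightarrow> 'k set \<Rightarrow> (('k \<times> 'a) \<times> 'u) set" where
  "matched f J = (\<Union>b\<in>J. {((b, \<one>), u b), (e b, snd (f b))})"

text \<open>The result \<open>r\<close> of a stage is the pseudometric on all orbits up to
  \<open>a\<close> together with the point of \<open>U\<close> chosen for \<open>e a\<close>.
  Agreement with earlier stages is part of the condition, which makes unions coherent. The update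
  \<open>f(a := r)\<close> is needed since the pairs of stage \<open>a\<close> already involve
  \<open>r\<close>.\<close>

definition stage :: "('k \<Rightarrow> ('k \<times> 'a \<Rightarrow> 'k \<times> 'a \<Rightarrow> real) \<times> 'u) \<Rightarrow> 'k \<Rightarrow>
    ('k \<times> 'a \<Rightarrow> 'k \<times> 'a \<Rightarrow> real) \<times> 'u \<Rightarrow> bool" where
  "stage f a r \<longleftrightarrow> orbits_pseudometric (under m a) (fst r) \<and>
     (\<forall>b\<in>underS m a. \<forall>x\<in>under m b \<times> carrier G. \<forall>y\<in>under m b \<times> carrier G. fst r x y = fst (f b) x y) \<and>
     snd r \<in> mspace U \<and>
     distance_preserving (fst r) (mdist U) (matched (f(a := r)) (under m a)) \<and>
     (underS m a = {} \<longrightarrow> (\<forall>g\<in>carrier G. \<forall>h\<in>carrier G. fst r (a, g) (a, h) = N (inv g \<otimes> h)))"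

text \<open>Evaluates at the larger of the two indices, the first stage at which both points
  exist.\<close>

definition glue :: "('k \<Rightarrow> ('k \<times> 'a \<Rightarrow> 'k \<times> 'a \<Rightarrow> real) \<times> 'u) \<Rightarrow> 'k \<times> 'a \<Rightarrow> 'k \<times> 'a \<Rightarrow> real" where
  "glue f x y = fst (f (if (fst x, fst y) \<in> m then fst y else fst x)) x y"

section \<open>Gluing compatible stages over initial segments\<close>

lemmas m_refl = Card_order_linear(1)[OF Card_m]
  and m_trans = Card_order_linear(2)[OF Card_m]
  and m_antisym = Card_order_linear(3)[OF Card_m]
  and m_total = Card_order_linear(4)[OF Card_m]
  and m_wf = Card_order_linear(5)[OF Card_m]

text \<open>Covers at once the stages before \<open>a\<close>, those up to \<open>a\<close>, and the
  whole of \<open>Field m\<close>; successor and limit stages need no separate treatment.\<close>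

definition initial :: "'k set \<Rightarrow> bool" where
  "initial J \<longleftrightarrow> J \<subseteq> Field m \<and> (\<forall>a\<in>J. under m a \<subseteq> J)"

lemma initial_Field: "initial (Field m)"
  unfolding initial_def under_def Field_def by blast

lemma initial_underS: "initial (underS m a)"
  unfolding initial_def under_def underS_def using m_trans m_antisym by (auto simp: Field_def)

lemma initial_under: "initial (under m a)"
  unfolding initial_def under_def Field_def using m_trans by blast

text \<open>Three indices, because the triangle inequality involves three points.\<close>

lemma initial_common_bound:
  assumes "initial J" "a \<in> J" "b \<in> J" "c \<in> J"
  shows "\<exists>d\<in>J. {a, b, c} \<subseteq> under m d"
proof -
  have F: "a \<in> Field m" "b \<in> Field m" "c \<in> Field m" using assms unfolding initial_def by auto
  have "\<exists>d\<in>{a, b, c}. {a, b, c} \<subseteq> under m d"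
    unfolding under_def using m_total F m_refl m_trans by (auto; metis)
  then show ?thesis using assms by blast
qed

lemma glue_eq:
  assumes J: "initial J" and f: "\<And>b. b \<in> J \<Longrightarrow> stage f b (f b)" and c: "c \<in> J"
    and xy: "x \<in> under m c \<times> carrier G" "y \<in> under m c \<times> carrier G"
  shows "glue f x y = fst (f c) x y"
proof -
  define d where "d = (if (fst x, fst y) \<in> m then fst y else fst x)"
  have xc: "(fst x, c) \<in> m" "(fst y, c) \<in> m" using xy by (auto simp: under_def)
  then have F: "fst x \<in> Field m" "fst y \<in> Field m" by (auto simp: Field_def)
  have dc: "(d, c) \<in> m" using xc by (simp add: d_def)
  have xd: "x \<in> under m d \<times> carrier G" "y \<in> under m d \<times> carrier G"
    using xy F m_total[OF F] m_refl by (auto simp: d_def under_def)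
  have "fst (f c) x y = fst (f d) x y"
  proof (cases "d = c")
    case False
    then have "d \<in> underS m c" using dc by (simp add: underS_def)
    then show ?thesis using f[OF c] xd unfolding stage_def by blast
  qed simp
  then show ?thesis by (simp add: glue_def d_def)
qed

lemma matched_subset:
  assumes J: "initial J" and f: "\<And>b. b \<in> J \<Longrightarrow> snd (f b) \<in> mspace U"
  shows "matched f J \<subseteq> (J \<times> carrier G) \<times> mspace U"
proof -
  have "e b \<in> J \<times> carrier G" "u b \<in> mspace U" if "b \<in> J" for b
  proof -
    have b: "b \<in> Field m" "under m b \<subseteq> J" using J that unfolding initial_def by auto
    show "e b \<in> J \<times> carrier G" "u b \<in> mspace U" using e_in[OF b(1)] u_in[OF b(1)] b(2) by auto
  qed
  then show ?thesis using f unfolding matched_def by (intro UN_least) simp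
qed

text \<open>Each axiom speaks of at most three points and their translates, which stay on the same
  orbits; all of them lie in a single stage, where the axiom is known.\<close>

lemma glue_orbits_pseudometric:
  assumes J: "initial J" and f: "\<And>b. b \<in> J \<Longrightarrow> stage f b (f b)"
  shows "orbits_pseudometric J (glue f)"
proof -
  have bound: "\<exists>c\<in>J. {x, y, z} \<subseteq> under m c \<times> carrier G"
    if "x \<in> J \<times> carrier G" "y \<in> J \<times> carrier G" "z \<in> J \<times> carrier G" for x y z
    using initial_common_bound[OF J, of "fst x" "fst y" "fst z"] that by (auto simp: mem_Times_iff)
  have eq: "glue f x y = fst (f c) x y"
    if "c \<in> J" "x \<in> under m c \<times> carrier G" "y \<in> under m c \<times> carrier G" for c x y
    by (rule glue_eq[OF J f]) (rule that | assumption)+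
  have O: "orbits_pseudometric (under m c) (fst (f c))" if "c \<in> J" for c
    using f[OF that] unfolding stage_def by simp
  show ?thesis
    unfolding orbits_pseudometric_def pseudometric_on_def
  proof (intro conjI ballI)
    fix x y z assume "x \<in> J \<times> carrier G" "y \<in> J \<times> carrier G" "z \<in> J \<times> carrier G"
    from bound[OF this] obtain c where c: "c \<in> J" "{x, y, z} \<subseteq> under m c \<times> carrier G"
      by (rule bexE)
    from c(2) have X: "x \<in> under m c \<times> carrier G" "y \<in> under m c \<times> carrier G" "z \<in> under m c \<times> carrier G"
      by (simp_all only: insert_subset)
    note D = pseudometric_on_D[OF orbits_pseudometric_D(1)[OF O[OF c(1)]]]
    show "glue f x x = 0" using D(1)[OF X(1)] by (simp only: eq[OF c(1) X(1) X(1)])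
    show "glue f x y = glue f y x"
      using D(2)[OF X(1,2)] by (simp only: eq[OF c(1) X(1,2)] eq[OF c(1) X(2,1)])
    show "glue f x z \<le> glue f x y + glue f y z"
      using D(3)[OF X] by (simp only: eq[OF c(1) X(1,2)] eq[OF c(1) X(2,3)] eq[OF c(1) X(1,3)])
  next
    fix g x y assume g: "g \<in> carrier G" and xy: "x \<in> J \<times> carrier G" "y \<in> J \<times> carrier G"
    from bound[OF xy xy(2)] obtain c where c: "c \<in> J" "{x, y, y} \<subseteq> under m c \<times> carrier G"
      by (rule bexE)
    from c(2) have X: "x \<in> under m c \<times> carrier G" "y \<in> under m c \<times> carrier G"
      by (simp_all only: insert_subset)
    show "glue f (act g x) (act g y) = glue f x y"
      using orbits_pseudometric_D(2)[OF O[OF c(1)] g X]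
      by (simp only: eq[OF c(1) X] eq[OF c(1) act_closed[OF g X(1)] act_closed[OF g X(2)]])
  next
    fix g x assume g: "g \<in> carrier G" and x: "x \<in> J \<times> carrier G"
    from bound[OF x x x] obtain c where c: "c \<in> J" "{x, x, x} \<subseteq> under m c \<times> carrier G"
      by (rule bexE)
    from c(2) have X: "x \<in> under m c \<times> carrier G"
      by (simp only: insert_subset)
    show "glue f (act g x) x \<le> N g"
      using orbits_pseudometric_D(3)[OF O[OF c(1)] g X] by (simp only: eq[OF c(1) act_closed[OF g X] X])
  qed
qed

lemma glue_distance_preserving:
  assumes J: "initial J" and f: "\<And>b. b \<in> J \<Longrightarrow> stage f b (f b)"
  shows "distance_preserving (glue f) (mdist U) (matched f J)"
proof -
  have "glue f s t = mdist U s' t'" if st: "(s, s') \<in> matched f J" "(t, t') \<in> matched f J" for s s' t t'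
  proof -
    obtain b c where bc: "b \<in> J" "c \<in> J" "(s, s') \<in> matched f {b}" "(t, t') \<in> matched f {c}"
      using st unfolding matched_def by blast
    obtain d where d: "d \<in> J" "{b, c, c} \<subseteq> under m d"
      using initial_common_bound[OF J bc(1,2,2)] by blast
    then have dF: "under m d \<subseteq> J" using J unfolding initial_def by blast
    have "initial (under m d)" by (rule initial_under)
    then have "matched f (under m d) \<subseteq> (under m d \<times> carrier G) \<times> mspace U"
      using dF f by (intro matched_subset) (auto simp: stage_def)
    moreover have R: "(s, s') \<in> matched f (under m d)" "(t, t') \<in> matched f (under m d)"
      using bc d unfolding matched_def by auto
    ultimately have "s \<in> under m d \<times> carrier G" "t \<in> under m d \<times> carrier G" by blast+
    then have glue: "glue f s t = fst (f d) s t"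
      by (intro glue_eq[OF J _ d(1)] f)
    have dp: "distance_preserving (fst (f d)) (mdist U) (matched f (under m d))"
      using f[OF d(1)] unfolding stage_def by simp
    show ?thesis using distance_preservingD[OF dp R] glue by simp
  qed
  then show ?thesis unfolding distance_preserving_def by blast
qed

text \<open>Keeps the matched points within reach of \<open>extension\<close>: proper initial
  segments of a cardinal order have fewer than \<open>m\<close> elements, and each index contributes
  two points of \<open>U\<close>.\<close>

lemma matched_small: "|snd ` matched f (underS m a)| <o m" if "a \<in> Field m"
proof -
  have "|underS m a| <o m" using Card_m that by (rule card_of_underS)
  then have "|h ` underS m a| <o m" for h :: "'k \<Rightarrow> 'u"
    using card_of_image ordLeq_ordLess_trans by blast
  then have "|u ` underS m a \<union> (\<lambda>b. snd (f b)) ` underS m a| <o m"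
    using Card_m cinf by (intro card_of_Un_ordLess_infinite_Field) (auto simp: cinfinite_def)
  moreover have "snd ` matched f (underS m a) = u ` underS m a \<union> (\<lambda>b. snd (f b)) ` underS m a"
    unfolding matched_def by force
  ultimately show ?thesis by simp
qed

lemma under_eq_insert: "a \<in> Field m \<Longrightarrow> under m a = insert a (underS m a)"
  unfolding under_def underS_def using m_refl by blast

text \<open>Stage \<open>a\<close> adds a new orbit with a point matched to \<open>u a\<close> ("back") and then
  matches the earlier point \<open>e a\<close> with a point of \<open>U\<close> ("forth").\<close>

lemma new_orbit:
  assumes a: "a \<in> Field m" and f: "\<And>b. b \<in> underS m a \<Longrightarrow> stage f b (f b)"
  shows "\<exists>D. orbits_pseudometric (under m a) D \<and>
    (\<forall>x\<in>underS m a \<times> carrier G. \<forall>y\<in>underS m a \<times> carrier G. D x y = glue f x y) \<and>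
    distance_preserving D (mdist U) (insert ((a, \<one>), u a) (matched f (underS m a))) \<and>
    (underS m a = {} \<longrightarrow> (\<forall>g\<in>carrier G. \<forall>h\<in>carrier G. D (a, g) (a, h) = N (inv g \<otimes> h)))"
proof -
  let ?J = "underS m a" and ?R = "matched f (underS m a)"
  have R: "?R \<subseteq> (?J \<times> carrier G) \<times> mspace U"
    using f by (intro matched_subset initial_underS) (simp add: stage_def)
  note ua = u_in[OF a]
  show ?thesis
  proof (cases "?J = {}")
    \<comment> \<open>At the least index nothing is matched yet and the amalgam would be an infimum
      over the empty set. Its orbit is taken to be \<open>G\<close> with its own metric, which later
      supplies the isometric copy of the group.\<close>
    case True
    then have "?R = {}" by (simp add: matched_def)
    moreover have "under m a = {a}" using under_eq_insert[OF a] True by simp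
    moreover have "distance_preserving (\<lambda>x y. N (inv (snd x) \<otimes> snd y)) (mdist U) {((a, \<one>), u a)}"
      using ua by (simp add: distance_preserving_def)
    ultimately show ?thesis
      using True orbits_pseudometric_singleton[of a]
      by (intro exI[of _ "\<lambda>x y. N (inv (snd x) \<otimes> snd y)"]) simp
  next
    case False
    have O: "orbits_pseudometric ?J (glue f)"
      using initial_underS f by (rule glue_orbits_pseudometric)
    have p: "distance_preserving (glue f) (mdist U) ?R"
      using initial_underS f by (rule glue_distance_preserving)
    have "?R \<noteq> {}" using False unfolding matched_def by blast
    from katetov_on_amalgam[OF orbits_pseudometric_D(1)[OF O] pseudometric_on_mdist R this p ua]
    obtain \<kappa> where \<kappa>: "katetov_on (?J \<times> carrier G) (glue f) \<kappa>" "\<forall>(s, s')\<in>?R. \<kappa> s = mdist U (u a) s'"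
      by blast
    have "a \<notin> ?J" by (simp add: underS_def)
    from orbits_pseudometric_extend[OF O False this \<kappa>(1)]
    obtain D where D: "orbits_pseudometric (insert a ?J) D"
        "\<forall>x\<in>?J \<times> carrier G. \<forall>y\<in>?J \<times> carrier G. D x y = glue f x y"
        "\<forall>x\<in>?J \<times> carrier G. D (a, \<one>) x = \<kappa> x"
      by blast
    have "distance_preserving D (mdist U) (insert ((a, \<one>), u a) ?R)"
    proof (rule distance_preserving_insert)
      show "pseudometric_on (insert a ?J \<times> carrier G) D" using D(1) by (rule orbits_pseudometric_D)
      show "pseudometric_on (mspace U) (mdist U)" by (rule pseudometric_on_mdist)
      show "?R \<subseteq> (insert a ?J \<times> carrier G) \<times> mspace U" using R by auto
      show "u a \<in> mspace U" by (rule ua)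
      show "(a, \<one>) \<in> insert a ?J \<times> carrier G" by simp
      show "distance_preserving D (mdist U) ?R"
        unfolding distance_preserving_def
      proof (clarify)
        fix b g s' c h t' assume st: "((b, g), s') \<in> ?R" "((c, h), t') \<in> ?R"
        then have "(b, g) \<in> ?J \<times> carrier G" "(c, h) \<in> ?J \<times> carrier G" using R by auto
        then have "D (b, g) (c, h) = glue f (b, g) (c, h)" using D(2) by blast
        then show "D (b, g) (c, h) = mdist U s' t'" using distance_preservingD[OF p st] by simp
      qed
      fix s s' assume s: "(s, s') \<in> ?R"
      then have "s \<in> ?J \<times> carrier G" using R by auto
      then have "D (a, \<one>) s = \<kappa> s" using D(3) by blast
      moreover have "\<kappa> s = mdist U (u a) s'" using \<kappa>(2) s by blast
      ultimately show "D (a, \<one>) s = mdist U (u a) s'" by simp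
    qed
    then show ?thesis
      using D(1,2) False under_eq_insert[OF a] by (intro exI[of _ D]) simp
  qed
qed

text \<open>With the new orbit in place, the distances from \<open>e a\<close> to the matched points
  are carried over to \<open>U\<close>, where fewer than \<open>m\<close> of them are prescribed,
  and \<open>extension\<close> realises them by a point \<open>z\<close>.\<close>

lemma stage_exists:
  assumes a: "a \<in> Field m" and f: "\<And>b. b \<in> underS m a \<Longrightarrow> stage f b (f b)"
  shows "\<exists>r. stage f a r"
proof -
  let ?J = "underS m a" and ?R = "matched f (underS m a)" and ?X = "under m a \<times> carrier G"
  obtain D where D: "orbits_pseudometric (under m a) D"
      "\<forall>x\<in>?J \<times> carrier G. \<forall>y\<in>?J \<times> carrier G. D x y = glue f x y"
      "distance_preserving D (mdist U) (insert ((a, \<one>), u a) ?R)"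
      "?J = {} \<longrightarrow> (\<forall>g\<in>carrier G. \<forall>h\<in>carrier G. D (a, g) (a, h) = N (inv g \<otimes> h))"
    using new_orbit[OF a f] by blast
  let ?R1 = "insert ((a, \<one>), u a) ?R"
  note pD = orbits_pseudometric_D(1)[OF D(1)]
  have aJ: "under m a = insert a ?J" by (rule under_eq_insert[OF a])
  have "?R \<subseteq> (?J \<times> carrier G) \<times> mspace U"
    using f by (intro matched_subset initial_underS) (simp add: stage_def)
  moreover have "u a \<in> mspace U" by (rule u_in[OF a])
  ultimately have R1: "?R1 \<subseteq> ?X \<times> mspace U" unfolding aJ by auto
  have ea: "e a \<in> ?X" by (rule e_in[OF a])
  \<comment> \<open>The pair just created has to be included, since \<open>z\<close> must be at the
    right distance from \<open>u a\<close> as well.\<close>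
  obtain \<kappa> where \<kappa>: "katetov_on (snd ` ?R1) (mdist U) \<kappa>" "\<forall>(s, s')\<in>?R1. \<kappa> s' = D (e a) s"
    using katetov_on_transfer[OF pD R1 D(3) ea] by blast
  have "|{u a}| <o m" using Card_m cinf by (intro finite_ordLess_cinfinite) auto
  then have "|{u a} \<union> snd ` ?R| <o m"
    using matched_small[OF a] Card_m cinf
    by (intro card_of_Un_ordLess_infinite_Field) (auto simp: cinfinite_def)
  then have "|snd ` ?R1| <o m" by simp
  moreover have "snd ` ?R1 \<subseteq> mspace U" using R1 by auto
  ultimately obtain z where z: "z \<in> mspace U" "\<forall>x\<in>snd ` ?R1. mdist U z x = \<kappa> x"
    using extension[OF _ _ \<kappa>(1)] by blast
  have p: "distance_preserving D (mdist U) (insert (e a, z) ?R1)"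
  proof (rule distance_preserving_insert[OF pD pseudometric_on_mdist R1 D(3) ea z(1)])
    fix s s' assume s: "(s, s') \<in> ?R1"
    then have "s' \<in> snd ` ?R1" by force
    then have "mdist U z s' = \<kappa> s'" using z(2) by blast
    moreover have "\<kappa> s' = D (e a) s" using \<kappa>(2) s by blast
    ultimately show "D (e a) s = mdist U z s'" by simp
  qed
  have "matched (f(a := (D, z))) (under m a) = insert (e a, z) ?R1"
  proof -
    have "matched (f(a := (D, z))) ?J = ?R"
      unfolding matched_def by (rule SUP_cong) (auto simp: underS_def)
    then show ?thesis unfolding aJ by (auto simp: matched_def)
  qed
  moreover have "D x y = fst (f b) x y"
    if b: "b \<in> ?J" and xy: "x \<in> under m b \<times> carrier G" "y \<in> under m b \<times> carrier G" for b x y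
  proof -
    have "under m b \<subseteq> ?J" using initial_underS b unfolding initial_def by blast
    then have "D x y = glue f x y" using D(2) xy by blast
    also have "\<dots> = fst (f b) x y" by (rule glue_eq[OF initial_underS f b xy])
    finally show ?thesis .
  qed
  ultimately have "stage f a (D, z)"
    unfolding stage_def using D(1,4) z(1) p by simp
  then show ?thesis by blast
qed

text \<open>Locality of the condition, as required for choice along a well-founded relation.\<close>

lemma stage_cong:
  assumes "\<And>b. b \<in> underS m a \<Longrightarrow> f b = g b"
  shows "stage f a r = stage g a r"
proof -
  have "matched (f(a := r)) (under m a) = matched (g(a := r)) (under m a)"
    unfolding matched_def
    by (rule SUP_cong) (use assms in \<open>auto simp: underS_def under_def\<close>)
  then show ?thesis unfolding stage_def using assms by simp
qed

theorem matching_exists: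
  obtains D R a where "orbits_pseudometric (Field m) D"
    and "R \<subseteq> (Field m \<times> carrier G) \<times> mspace U" and "distance_preserving D (mdist U) R"
    and "\<And>b. b \<in> Field m \<Longrightarrow> u b \<in> Range R" and "\<And>b. b \<in> Field m \<Longrightarrow> e b \<in> Domain R"
    and "a \<in> Field m" and "\<And>g h. g \<in> carrier G \<Longrightarrow> h \<in> carrier G \<Longrightarrow> D (a, g) (a, h) = N (inv g \<otimes> h)"
proof -
  have below: "(b, a) \<in> m - Id \<longleftrightarrow> b \<in> underS m a" for a b by (auto simp: underS_def)
  have "\<exists>f. \<forall>a. a \<in> Field m \<longrightarrow> stage f a (f a)"
  proof (rule dependent_wf_choice[OF m_wf])
    fix f g :: "'k \<Rightarrow> ('k \<times> 'a \<Rightarrow> 'k \<times> 'a \<Rightarrow> real) \<times> 'u" and a r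
    assume "\<And>b. (b, a) \<in> m - Id \<Longrightarrow> f b = g b"
    then have "stage f a r = stage g a r" by (intro stage_cong) (simp add: underS_def)
    then show "(a \<in> Field m \<longrightarrow> stage f a r) = (a \<in> Field m \<longrightarrow> stage g a r)" by simp
  next
    fix a f assume f: "\<And>b. (b, a) \<in> m - Id \<Longrightarrow> b \<in> Field m \<longrightarrow> stage f b (f b)"
    have "stage f b (f b)" if "b \<in> underS m a" for b
      using f[of b] that unfolding below by (auto simp: underS_def Field_def)
    then show "\<exists>r. a \<in> Field m \<longrightarrow> stage f a r" using stage_exists by blast
  qed
  then obtain f where f: "\<And>a. a \<in> Field m \<Longrightarrow> stage f a (f a)" by blast
  have "Field m \<noteq> {}" using cinf unfolding cinfinite_def by auto
  \<comment> \<open>The least index, whose orbit carries the metric of \<open>G\<close> by the last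
    clause of \<open>stage\<close>.\<close>
  then obtain a where a: "a \<in> Field m" "\<And>b. (b, a) \<in> m - Id \<Longrightarrow> b \<notin> Field m"
    using wfE_min[OF m_wf] by (metis ex_in_conv)
  then have aS: "underS m a = {}" unfolding below by (auto simp: underS_def Field_def)
  show thesis
  proof (rule that)
    show "orbits_pseudometric (Field m) (glue f)"
      using initial_Field f by (rule glue_orbits_pseudometric)
    show "distance_preserving (glue f) (mdist U) (matched f (Field m))"
      using initial_Field f by (rule glue_distance_preserving)
    show "matched f (Field m) \<subseteq> (Field m \<times> carrier G) \<times> mspace U"
      using f by (intro matched_subset initial_Field) (simp add: stage_def)
    show "u b \<in> Range (matched f (Field m))" "e b \<in> Domain (matched f (Field m))" if "b \<in> Field m" for b
      using that unfolding matched_def by blast+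
    show "a \<in> Field m" by fact
    fix g h assume gh: "g \<in> carrier G" "h \<in> carrier G"
    then have "glue f (a, g) (a, h) = fst (f a) (a, g) (a, h)"
      using m_refl[OF a(1)] by (intro glue_eq[OF initial_Field f a(1)]) (auto simp: under_def)
    then show "glue f (a, g) (a, h) = N (inv g \<otimes> h)"
      using f[OF a(1)] aS gh unfolding stage_def by simp
  qed
qed

end

text \<open>Each task is enumerated \<open>m\<close> times, hence at arbitrarily late stages.\<close>

lemma bookkeeping:
  assumes m: "Card_order m" "cinfinite m" and B: "|B| \<le>o m"
  shows "\<exists>e. (\<forall>a\<in>Field m. e a \<in> under m a \<times> insert c B) \<and>
    (\<forall>b\<in>Field m. \<forall>x\<in>B. \<exists>a\<in>Field m. e a = (b, x))"
proof -
  have inf: "\<not> finite (Field m)" using m(2) by (simp add: cinfinite_def)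
  have Fm: "|Field m| \<le>o m" using card_of_Field_ordIso[OF m(1)] ordIso_iff_ordLeq by blast
  have "|Field m \<times> B| \<le>o m" using inf Fm B m(1) by (rule card_of_Times_ordLeq_infinite_Field)
  \<comment> \<open>The additional factor \<open>Field m\<close> labels the \<open>m\<close> copies
    of each task; \<open>s\<close> will code the labelled tasks by stages.\<close>
  with inf Fm have "|Field m \<times> (Field m \<times> B)| \<le>o m" using m(1) by (rule card_of_Times_ordLeq_infinite_Field)
  then have "|Field m \<times> (Field m \<times> B)| \<le>o |Field m|"
    using ordIso_symmetric[OF card_of_Field_ordIso[OF m(1)]] by (rule ordLeq_ordIso_trans)
  then obtain s where s: "inj_on s (Field m \<times> (Field m \<times> B))" "s ` (Field m \<times> (Field m \<times> B)) \<subseteq> Field m"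
    using card_of_ordLeq[of "Field m \<times> (Field m \<times> B)" "Field m"] by blast
  define ok where "ok a b x \<longleftrightarrow> (\<exists>k\<in>Field m. b \<in> under m a \<and> x \<in> B \<and> a = s (k, (b, x)))" for a b x
  have refl: "a \<in> under m a" if "a \<in> Field m" for a
    using Card_order_linear(1)[OF m(1) that] by (simp add: under_def)
  \<comment> \<open>A stage that codes no task, or one whose orbit does not exist yet, falls back on
    a point of its own orbit; \<open>c\<close> is the default group element.\<close>
  define e where "e a = (if \<exists>q. ok a (fst q) (snd q) then (SOME q. ok a (fst q) (snd q)) else (a, c))" for a
  show ?thesis
  proof (intro exI[of _ e] conjI ballI)
    fix a assume a: "a \<in> Field m"
    show "e a \<in> under m a \<times> insert c B"
    proof (cases "\<exists>q. ok a (fst q) (snd q)")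
      case True
      from someI_ex[OF True] have "ok a (fst (e a)) (snd (e a))" using True by (simp add: e_def)
      then show ?thesis unfolding ok_def by (auto simp: mem_Times_iff)
    next
      case False
      then show ?thesis using refl[OF a] by (simp add: e_def)
    qed
  next
    fix b x assume b: "b \<in> Field m" and x: "x \<in> B"
    \<comment> \<open>Not all copies of the task can be coded before \<open>b\<close>, as that would
      inject \<open>Field m\<close> into a proper initial segment.\<close>
    have "\<exists>k\<in>Field m. s (k, (b, x)) \<notin> underS m b"
    proof (rule ccontr)
      assume "\<not> ?thesis"
      then have "(\<lambda>k. s (k, (b, x))) ` Field m \<subseteq> underS m b" by blast
      moreover have "inj_on (\<lambda>k. s (k, (b, x))) (Field m)"
        using s(1) b x by (auto simp: inj_on_def)
      ultimately have "|Field m| \<le>o |underS m b|" using card_of_ordLeq by blast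
      then have "|Field m| <o m" using card_of_underS[OF m(1) b] ordLeq_ordLess_trans by blast
      then show False using card_of_Field_ordIso[OF m(1)] not_ordLess_ordIso by blast
    qed
    then obtain k where k: "k \<in> Field m" "s (k, (b, x)) \<notin> underS m b" by blast
    define a where "a = s (k, (b, x))"
    have a: "a \<in> Field m" using s(2) k(1) b x unfolding a_def by blast
    have "b \<in> under m a"
      using Card_order_linear(1)[OF m(1) b] Card_order_linear(4)[OF m(1) b a] k(2)
      unfolding a_def[symmetric] by (auto simp: under_def underS_def)
    then have "ok a b x" unfolding ok_def using k(1) x a_def by (intro bexI[of _ k] conjI)
    then have ex: "\<exists>q. ok a (fst q) (snd q)" by (intro exI[of _ "(b, x)"]) simp
    \<comment> \<open>The choice in \<open>e\<close> might return another task with code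
      \<open>a\<close>; injectivity of \<open>s\<close> excludes this.\<close>
    from someI_ex[OF this] have "ok a (fst (e a)) (snd (e a))" using ex by (simp add: e_def)
    then obtain k' where "k' \<in> Field m" "fst (e a) \<in> under m a" "snd (e a) \<in> B" "a = s (k', e a)"
      unfolding ok_def by auto
    moreover from this have "fst (e a) \<in> Field m" by (auto simp: under_def Field_def)
    ultimately have "(k', e a) = (k, (b, x))"
      using s(1) k(1) b x unfolding a_def by (intro inj_onD[OF s(1)]) (auto simp: mem_Times_iff)
    then show "\<exists>a\<in>Field m. e a = (b, x)" using a by blast
  qed
qed

section \<open>Extending the action to the completion\<close>

text \<open>Approximating \<open>y1\<close> alone suffices: for a matched \<open>s\<close> near
  \<open>y1\<close>, both \<open>d z1 z2\<close> and \<open>D y1 y2\<close> differ from the common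
  number \<open>d z2 s' = D y2 s\<close> by at most \<open>D y1 s\<close>.\<close>

lemma completion_dist:
  assumes D: "pseudometric_on X D" and d: "pseudometric_on Y d" and R: "R \<subseteq> X \<times> Y"
    and y: "y1 \<in> X" "y2 \<in> X" and z: "z1 \<in> Y" "z2 \<in> Y"
    and 1: "\<And>s s'. (s, s') \<in> R \<Longrightarrow> d z1 s' = D y1 s" and 2: "\<And>s s'. (s, s') \<in> R \<Longrightarrow> d z2 s' = D y2 s"
    and near: "\<And>\<epsilon>. 0 < \<epsilon> \<Longrightarrow> \<exists>(s, s')\<in>R. D y1 s < \<epsilon>"
  shows "d z1 z2 = D y1 y2"
proof -
  have "\<bar>d z1 z2 - D y1 y2\<bar> \<le> \<epsilon>" if "0 < \<epsilon>" for \<epsilon>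
  proof -
    obtain s s' where s: "(s, s') \<in> R" "D y1 s < \<epsilon> / 2" using near[of "\<epsilon> / 2"] \<open>0 < \<epsilon>\<close> by auto
    then have X: "s \<in> X" "s' \<in> Y" using R by auto
    have "d z1 z2 \<le> d z1 s' + d z2 s'" "d z2 s' \<le> d z1 z2 + d z1 s'"
      using pseudometric_on_D(3)[OF d z(1) X(2) z(2)] pseudometric_on_D(3)[OF d z(2,1) X(2)]
        pseudometric_on_D(2)[OF d X(2) z(2)] pseudometric_on_D(2)[OF d z] by simp_all
    moreover have "D y1 y2 \<le> D y1 s + D y2 s" "D y2 s \<le> D y1 y2 + D y1 s"
      using pseudometric_on_D(3)[OF D y(1) X(1) y(2)] pseudometric_on_D(3)[OF D y(2,1) X(1)]
        pseudometric_on_D(2)[OF D X(1) y(2)] pseudometric_on_D(2)[OF D y] by simp_all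
    ultimately show ?thesis using 1[OF s(1)] 2[OF s(1)] s(2) by simp
  qed
  then have "\<bar>d z1 z2 - D y1 y2\<bar> \<le> 0" using field_le_epsilon[of "\<bar>d z1 z2 - D y1 y2\<bar>" 0] by simp
  then show ?thesis by simp
qed

text \<open>The partners of a sequence converging to \<open>y\<close> form a Cauchy sequence, and
  its limit is \<open>z\<close>. Applied to the matching this sends orbit points into
  \<open>U\<close>; applied to the translation by \<open>g\<close> on a dense subset of
  \<open>U\<close> it extends that translation to \<open>U\<close>.\<close>

lemma completion_point:
  assumes D: "pseudometric_on X D" and U: "mcomplete_of U" and R: "R \<subseteq> X \<times> mspace U"
    and p: "distance_preserving D (mdist U) R" and y: "y \<in> X"
    and near: "\<And>\<epsilon>. 0 < \<epsilon> \<Longrightarrow> \<exists>(s, s')\<in>R. D y s < \<epsilon>"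
  shows "\<exists>z\<in>mspace U. \<forall>(s, s')\<in>R. mdist U z s' = D y s"
proof -
  interpret U: Metric_space "mspace U" "mdist U" by simp
  have "\<forall>n. \<exists>q. q \<in> R \<and> D y (fst q) < inverse (real (Suc n))"
  proof
    fix n
    show "\<exists>q. q \<in> R \<and> D y (fst q) < inverse (real (Suc n))"
      using near[of "inverse (real (Suc n))"] by auto
  qed
  then obtain q where q: "\<And>n. q n \<in> R" "\<And>n. D y (fst (q n)) < inverse (real (Suc n))" by metis
  define s b where "s n = fst (q n)" and "b n = snd (q n)" for n
  have sb: "(s n, b n) \<in> R" "s n \<in> X" "b n \<in> mspace U" for n
    using q(1)[of n] R unfolding s_def b_def by auto
  have small: "D y (s n) < \<epsilon>" if "inverse (real (Suc k)) < \<epsilon>" "k \<le> n" for k n \<epsilon>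
  proof -
    have "inverse (real (Suc n)) \<le> inverse (real (Suc k))" using that(2) by simp
    then show ?thesis using q(2)[of n] that(1) unfolding s_def by linarith
  qed
  have tri: "mdist U (b n) t' \<le> D y (s n) + D y t" "D y t \<le> mdist U (b n) t' + D y (s n)"
    if "(t, t') \<in> R" for n t t'
  proof -
    have t: "t \<in> X" using that R by auto
    show "mdist U (b n) t' \<le> D y (s n) + D y t" "D y t \<le> mdist U (b n) t' + D y (s n)"
      using distance_preservingD[OF p sb(1)[of n] that] pseudometric_on_D(3)[OF D sb(2)[of n] y t]
        pseudometric_on_D(3)[OF D y sb(2)[of n] t] pseudometric_on_D(2)[OF D y sb(2)[of n]] by simp_all
  qed
  have "U.MCauchy b"
    unfolding U.MCauchy_def
  proof (intro conjI allI impI)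
    show "range b \<subseteq> mspace U" using sb(3) by auto
    fix \<epsilon> :: real assume "0 < \<epsilon>"
    then obtain k where k: "inverse (real (Suc k)) < \<epsilon> / 2" using reals_Archimedean[of "\<epsilon> / 2"] by auto
    show "\<exists>k. \<forall>n n'. k \<le> n \<longrightarrow> k \<le> n' \<longrightarrow> mdist U (b n) (b n') < \<epsilon>"
    proof (intro exI[of _ k] allI impI)
      fix n n' assume "k \<le> n" "k \<le> n'"
      then show "mdist U (b n) (b n') < \<epsilon>"
        using tri(1)[OF sb(1)[of n'], of n] small[OF k, of n] small[OF k, of n'] by linarith
    qed
  qed
  then obtain z where z: "limitin U.mtopology b z sequentially"
    using U unfolding mcomplete_of_def U.mcomplete_def by blast
  then have zU: "z \<in> mspace U" by (rule U.limitin_mspace)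
  have "mdist U z t' = D y t" if t: "(t, t') \<in> R" for t t'
  proof -
    have t': "t' \<in> mspace U" using t R by auto
    have "\<bar>mdist U z t' - D y t\<bar> \<le> \<epsilon>" if e: "0 < \<epsilon>" for \<epsilon>
    proof -
      obtain k where k: "inverse (real (Suc k)) < \<epsilon> / 2" using reals_Archimedean[OF half_gt_zero[OF e]] by blast
      have "\<forall>\<^sub>F n in sequentially. mdist U (b n) z < \<epsilon> / 2"
        using z[unfolded U.limitin_metric, THEN conjunct2, THEN spec, THEN mp, OF half_gt_zero[OF e]]
        by (rule eventually_mono) (rule conjunct2)
      moreover have "\<forall>\<^sub>F n in sequentially. k \<le> n" by (rule eventually_ge_at_top)
      ultimately have "\<forall>\<^sub>F n in sequentially. mdist U (b n) z < \<epsilon> / 2 \<and> k \<le> n" by (rule eventually_conj)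
      then obtain n where n: "mdist U (b n) z < \<epsilon> / 2" "k \<le> n"
        using eventually_happens by fastforce
      have "mdist U z t' \<le> mdist U (b n) z + mdist U (b n) t'" "mdist U (b n) t' \<le> mdist U (b n) z + mdist U z t'"
        using U.triangle[OF zU sb(3)[of n] t'] U.triangle[OF sb(3)[of n] zU t'] U.commute[of z "b n"] by simp_all
      then show ?thesis using tri[OF t, of n] small[OF k n(2)] n(1) by linarith
    qed
    then have "\<bar>mdist U z t' - D y t\<bar> \<le> 0" using field_le_epsilon[of "\<bar>mdist U z t' - D y t\<bar>" 0] by simp
    then show ?thesis by simp
  qed
  then show ?thesis using zU by blast
qed

section \<open>From an action on a dense subset to an action on the complete space\<close>

locale dense_action = group_length G N for G (structure) and N +
  fixes I :: "'i set" and D :: "'i \<times> 'a \<Rightarrow> 'i \<times> 'a \<Rightarrow> real" and U :: "'u metric"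
    and \<psi> :: "'i \<times> 'a \<Rightarrow> 'u" and a :: 'i
  assumes O: "orbits_pseudometric I D"
    and complete: "mcomplete_of U"
    and psi_in: "x \<in> I \<times> carrier G \<Longrightarrow> \<psi> x \<in> mspace U"
    and psi_dist: "x \<in> I \<times> carrier G \<Longrightarrow> y \<in> I \<times> carrier G \<Longrightarrow> mdist U (\<psi> x) (\<psi> y) = D x y"
    and psi_dense: "w \<in> mspace U \<Longrightarrow> 0 < \<epsilon> \<Longrightarrow> \<exists>x\<in>I \<times> carrier G. mdist U w (\<psi> x) < \<epsilon>"
    and a: "a \<in> I"
    and base: "g \<in> carrier G \<Longrightarrow> h \<in> carrier G \<Longrightarrow> D (a, g) (a, h) = N (inv g \<otimes> h)"
begin

abbreviation X where "X \<equiv> I \<times> carrier G"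

sublocale U: Metric_space "mspace U" "mdist U" by simp

text \<open>The image of \<open>w\<close> is specified by its distances to a dense set instead of as
  a limit. The algebraic laws then follow by comparing distances and invoking uniqueness.\<close>

definition \<Phi> :: "'a \<Rightarrow> 'u \<Rightarrow> 'u" where
  "\<Phi> g w = (SOME z. z \<in> mspace U \<and> (\<forall>x\<in>X. mdist U z (\<psi> (act g x)) = mdist U w (\<psi> x)))"

lemma \<Phi>:
  assumes g: "g \<in> carrier G" and w: "w \<in> mspace U"
  shows "\<Phi> g w \<in> mspace U" "x \<in> X \<Longrightarrow> mdist U (\<Phi> g w) (\<psi> (act g x)) = mdist U w (\<psi> x)"
proof -
  let ?R = "(\<lambda>x. (\<psi> x, \<psi> (act g x))) ` X"
  have p: "distance_preserving (mdist U) (mdist U) ?R"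
    unfolding distance_preserving_def
    using g by (auto simp: psi_dist orbits_pseudometric_D(2)[OF O])
  have R: "?R \<subseteq> mspace U \<times> mspace U"
    by (intro image_subsetI SigmaI psi_in act_closed g)
  have "\<exists>z\<in>mspace U. \<forall>(s, s')\<in>?R. mdist U z s' = mdist U w s"
  proof (rule completion_point[OF pseudometric_on_mdist complete R p w])
    show "\<exists>(s, s')\<in>?R. mdist U w s < \<epsilon>" if "0 < \<epsilon>" for \<epsilon>
      using psi_dense[OF w that] by simp
  qed
  then have "\<exists>z. z \<in> mspace U \<and> (\<forall>x\<in>X. mdist U z (\<psi> (act g x)) = mdist U w (\<psi> x))" by auto
  from someI_ex[OF this]
  show "\<Phi> g w \<in> mspace U" "x \<in> X \<Longrightarrow> mdist U (\<Phi> g w) (\<psi> (act g x)) = mdist U w (\<psi> x)"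
    unfolding \<Phi>_def by blast+
qed

text \<open>Leaving \<open>z\<close> arbitrary serves two ends: \<open>z = \<Phi> g w'\<close> gives
  the isometry property, and \<open>w' = w\<close> gives uniqueness.\<close>

lemma \<Phi>_dist:
  assumes g: "g \<in> carrier G" and w: "w \<in> mspace U" "w' \<in> mspace U" and z: "z \<in> mspace U"
    and eq: "\<And>x. x \<in> X \<Longrightarrow> mdist U z (\<psi> (act g x)) = mdist U w' (\<psi> x)"
  shows "mdist U (\<Phi> g w) z = mdist U w w'"
proof (rule completion_dist[OF pseudometric_on_mdist pseudometric_on_mdist])
  let ?R = "(\<lambda>x. (\<psi> x, \<psi> (act g x))) ` X"
  show "?R \<subseteq> mspace U \<times> mspace U"
    by (intro image_subsetI SigmaI psi_in act_closed g)
  show "mdist U (\<Phi> g w) s' = mdist U w s" "mdist U z s' = mdist U w' s" if "(s, s') \<in> ?R" for s s'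
    using that \<Phi>(2)[OF g w(1)] eq by auto
  show "\<exists>(s, s')\<in>?R. mdist U w s < \<epsilon>" if "0 < \<epsilon>" for \<epsilon>
    using psi_dense[OF w(1) that] by simp
qed (use w z \<Phi>(1)[OF g w(1)] in auto)

lemma \<Phi>_isometry:
  "g \<in> carrier G \<Longrightarrow> w \<in> mspace U \<Longrightarrow> w' \<in> mspace U \<Longrightarrow> mdist U (\<Phi> g w) (\<Phi> g w') = mdist U w w'"
  by (rule \<Phi>_dist) (auto simp: \<Phi>)

lemma \<Phi>_unique:
  assumes "g \<in> carrier G" "w \<in> mspace U" "z \<in> mspace U"
    and "\<And>x. x \<in> X \<Longrightarrow> mdist U z (\<psi> (act g x)) = mdist U w (\<psi> x)"
  shows "\<Phi> g w = z"
proof -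
  have "mdist U (\<Phi> g w) z = mdist U w w" using assms by (intro \<Phi>_dist)
  then show ?thesis using assms \<Phi>(1)[OF assms(1,2)] by simp
qed

lemma \<Phi>_mult:
  assumes g: "g \<in> carrier G" and h: "h \<in> carrier G" and w: "w \<in> mspace U"
  shows "\<Phi> (g \<otimes> h) w = \<Phi> g (\<Phi> h w)"
proof (rule \<Phi>_unique)
  show "\<Phi> g (\<Phi> h w) \<in> mspace U" by (intro \<Phi> assms)
  fix x assume x: "x \<in> X"
  have "mdist U (\<Phi> g (\<Phi> h w)) (\<psi> (act g (act h x))) = mdist U (\<Phi> h w) (\<psi> (act h x))"
    using x h by (intro \<Phi>(2) g \<Phi>(1) w act_closed)
  also have "\<dots> = mdist U w (\<psi> x)" by (intro \<Phi>(2) h w x)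
  finally show "mdist U (\<Phi> g (\<Phi> h w)) (\<psi> (act (g \<otimes> h) x)) = mdist U w (\<psi> x)"
    using act_mult[OF g h x] by simp
qed (use assms in auto)

lemma \<Phi>_one: "w \<in> mspace U \<Longrightarrow> \<Phi> \<one> w = w"
  by (rule \<Phi>_unique) auto

lemma \<Phi>_\<psi>:
  assumes g: "g \<in> carrier G" and x: "x \<in> X"
  shows "\<Phi> g (\<psi> x) = \<psi> (act g x)"
proof (rule \<Phi>_unique[OF g psi_in[OF x] psi_in[OF act_closed[OF g x]]])
  fix y assume y: "y \<in> X"
  show "mdist U (\<psi> (act g x)) (\<psi> (act g y)) = mdist U (\<psi> x) (\<psi> y)"
    by (simp only: psi_dist x y act_closed[OF g x] act_closed[OF g y] orbits_pseudometric_D(2)[OF O g x y])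
qed

text \<open>For \<open>\<psi> x\<close> near \<open>w\<close>, the error between
  \<open>\<Phi> g w\<close> and \<open>\<psi> (act g x)\<close> equals that between \<open>w\<close>
  and \<open>\<psi> x\<close>; each takes half of the allowance, and the bound on the orbits passes
  to the closure.\<close>

lemma \<Phi>_displacement:
  assumes g: "g \<in> carrier G" and w: "w \<in> mspace U"
  shows "mdist U (\<Phi> g w) w \<le> N g"
proof (rule field_le_epsilon)
  fix \<epsilon> :: real assume "0 < \<epsilon>"
  then obtain x where x: "x \<in> X" "mdist U w (\<psi> x) < \<epsilon> / 2" using psi_dense[OF w, of "\<epsilon> / 2"] by auto
  have gx: "act g x \<in> X" using g x(1) by (rule act_closed)
  note V = \<Phi>(1)[OF g w] psi_in[OF x(1)] psi_in[OF gx]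
  have "mdist U (\<Phi> g w) w \<le> mdist U (\<Phi> g w) (\<psi> (act g x)) + mdist U (\<psi> (act g x)) w"
    by (rule U.triangle[OF V(1,3) w])
  also have "mdist U (\<psi> (act g x)) w \<le> mdist U (\<psi> (act g x)) (\<psi> x) + mdist U (\<psi> x) w"
    by (rule U.triangle[OF V(3,2) w])
  also have "mdist U (\<psi> (act g x)) (\<psi> x) \<le> N g"
    unfolding psi_dist[OF gx x(1)] by (rule orbits_pseudometric_D(3)[OF O g x(1)])
  finally show "mdist U (\<Phi> g w) w \<le> N g + \<epsilon>"
    using \<Phi>(2)[OF g w x(1)] x(2) U.commute[of w "\<psi> x"] by simp
qed

definition \<phi> :: "'a \<Rightarrow> 'u \<Rightarrow> 'u" where
  "\<phi> g = (\<lambda>w\<in>mspace U. \<Phi> g w)"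

lemma \<phi>_in: assumes g: "g \<in> carrier G" shows "\<phi> g \<in> carrier (isometry_group U)"
proof -
  have "bij_betw (\<Phi> g) (mspace U) (mspace U)"
  proof (rule bij_betw_byWitness[where f' = "\<Phi> (inv g)"])
    show "\<forall>w\<in>mspace U. \<Phi> (inv g) (\<Phi> g w) = w" "\<forall>w\<in>mspace U. \<Phi> g (\<Phi> (inv g) w) = w"
      using g by (simp_all add: \<Phi>_mult[symmetric] \<Phi>_one)
  qed (use g \<Phi>(1) in auto)
  then have "\<phi> g \<in> Bij (mspace U)" by (simp add: Bij_def \<phi>_def bij_betw_restrict_eq)
  then show ?thesis
    unfolding isometry_group_def isometric_map_def
    using g by (auto simp: \<phi>_def \<Phi>_isometry \<Phi>(1))
qed

lemma \<phi>_hom: "\<phi> \<in> hom G (isometry_group U)"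
proof (rule homI)
  fix g h assume gh: "g \<in> carrier G" "h \<in> carrier G"
  have "\<phi> g \<in> Bij (mspace U)" "\<phi> h \<in> Bij (mspace U)"
    using \<phi>_in gh unfolding isometry_group_def by auto
  then have "\<phi> g \<otimes>\<^bsub>isometry_group U\<^esub> \<phi> h = compose (mspace U) (\<phi> g) (\<phi> h)"
    by (simp add: isometry_group_def BijGroup_def)
  also have "\<dots> = \<phi> (g \<otimes> h)"
    using gh by (auto simp: compose_def \<phi>_def \<Phi>_mult \<Phi>(1))
  finally show "\<phi> (g \<otimes> h) = \<phi> g \<otimes>\<^bsub>isometry_group U\<^esub> \<phi> h" by simp
qed (rule \<phi>_in)

text \<open>Evaluation at the single point \<open>\<psi> (a, \<one>)\<close> recovers the metric of
  the group, which yields both injectivity and openness of \<open>\<phi>\<close>.\<close>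

lemma \<phi>_base_dist:
  assumes "g \<in> carrier G" "h \<in> carrier G"
  shows "mdist U (\<phi> g (\<psi> (a, \<one>))) (\<phi> h (\<psi> (a, \<one>))) = N (inv g \<otimes> h)"
proof -
  have "\<phi> k (\<psi> (a, \<one>)) = \<psi> (a, k)" if "k \<in> carrier G" for k
    using that psi_in[of "(a, \<one>)"] a \<Phi>_\<psi>[OF that, of "(a, \<one>)"] by (simp add: \<phi>_def act_def)
  then show ?thesis using assms a by (simp add: psi_dist base)
qed

lemma \<phi>_inj: "inj_on \<phi> (carrier G)"
proof (rule inj_onI)
  fix g h assume gh: "g \<in> carrier G" "h \<in> carrier G" "\<phi> g = \<phi> h"
  then have "N (inv g \<otimes> h) = N (inv h \<otimes> h)"
    using \<phi>_base_dist[of g h] \<phi>_base_dist[of h h] by simp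
  then have "inv g \<otimes> h = \<one>" using gh by (intro N_eq_0) auto
  then have "g \<otimes> (inv g \<otimes> h) = g" using gh by simp
  then show "g = h" using gh by simp
qed

text \<open>The two directions use different information. Continuity must be checked at every point
  of \<open>U\<close> and rests on the displacement bound; openness is witnessed by one point, at
  which displacement equals the length.\<close>

lemma embeds_topologically_isometry_group:
  assumes top: "topspace T = carrier G"
    and T: "\<And>S. openin T S \<longleftrightarrow> S \<subseteq> carrier G \<and>
      (\<forall>x\<in>S. \<exists>e>0. \<forall>y\<in>carrier G. N (inv x \<otimes> y) < e \<longrightarrow> y \<in> S)"
  shows "embeds_topologically G T (isometry_group U) (isometry_topology U)"
proof -
  let ?K = "isometry_group U" and ?H = "\<phi> ` carrier G"
  interpret K: group ?K by (rule group_isometry_group)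
  interpret \<phi>: group_hom G ?K \<phi> by unfold_locales (rule \<phi>_hom)
  have H: "subgroup ?H ?K" by (rule \<phi>.img_is_subgroup)
  have HK: "?H \<subseteq> carrier ?K" using \<phi>_in by blast
  have "\<phi> \<in> iso G (?K\<lparr>carrier := ?H\<rparr>)"
    using \<phi>_hom \<phi>_inj by (auto simp: iso_def hom_def bij_betw_def)
  let ?P = "product_topology (\<lambda>_. mtopology_of U) (mspace U)"
  let ?S = "subtopology (isometry_topology U) ?H"
  have S: "?S = subtopology ?P ?H"
    unfolding isometry_topology_def subtopology_subtopology using HK by (simp add: Int_absorb1)
  have ext: "?H \<subseteq> extensional (mspace U)" by (auto simp: \<phi>_def)
  have topP: "topspace ?P = mspace U \<rightarrow>\<^sub>E mspace U" by simp
  have HP: "?H \<subseteq> topspace ?P" unfolding topP by (auto simp: \<phi>_def \<Phi>(1))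
  have topS: "topspace ?S = ?H" unfolding S topspace_subtopology using HP by blast
  have "continuous_map T ?S \<phi>"
    unfolding S continuous_map_in_subtopology continuous_map_componentwise top
  proof (intro conjI ballI)
    show "\<phi> ` carrier G \<subseteq> extensional (mspace U)" by (rule ext)
    show "\<phi> \<in> carrier G \<rightarrow> ?H" by blast
    fix w assume w: "w \<in> mspace U"
    show "continuous_map T (mtopology_of U) (\<lambda>g. \<phi> g w)"
      unfolding mtopology_of_def U.continuous_map_to_metric top
    proof (intro ballI allI impI)
      fix x and \<epsilon> :: real assume x: "x \<in> carrier G" and \<epsilon>: "0 < \<epsilon>"
      let ?O = "{y \<in> carrier G. N (inv x \<otimes> y) < \<epsilon>}"
      have "openin T ?O" using T x by (rule openin_length_ball)
      moreover have "x \<in> ?O" using x \<epsilon> by simp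
      moreover have "\<phi> y w \<in> U.mball (\<phi> x w) \<epsilon>" if "y \<in> ?O" for y
      proof -
        let ?v = "\<Phi> (inv x \<otimes> y) w"
        have y: "y \<in> carrier G" "N (inv x \<otimes> y) < \<epsilon>" using that by auto
        have k: "inv x \<otimes> y \<in> carrier G" using x y by simp
        \<comment> \<open>Cancelling the isometry \<open>\<Phi> x\<close> turns continuity at
          \<open>x\<close> into the displacement of \<open>w\<close> under
          \<open>inv x \<otimes> y\<close>, whose bound does not depend on \<open>w\<close>.\<close>
        have "\<Phi> y w = \<Phi> x ?v" using \<Phi>_mult[OF x k w] x y by simp
        then have "mdist U (\<Phi> x w) (\<Phi> y w) = mdist U w ?v"
          using \<Phi>_isometry[OF x w \<Phi>(1)[OF k w]] by simp
        also have "\<dots> \<le> N (inv x \<otimes> y)" using \<Phi>_displacement[OF k w] U.commute by metis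
        finally show ?thesis using w x y \<Phi>(1)[of _ w] by (simp add: \<phi>_def)
      qed
      ultimately show "\<exists>O'. openin T O' \<and> x \<in> O' \<and> (\<forall>y\<in>O'. \<phi> y w \<in> U.mball (\<phi> x w) \<epsilon>)" by blast
    qed
  qed
  moreover have "open_map T ?S \<phi>"
    unfolding open_map_def
  proof (intro allI impI)
    fix W assume W: "openin T W"
    let ?z = "\<psi> (a, \<one>)"
    have z: "?z \<in> mspace U" using a by (intro psi_in) auto
    have ev: "continuous_map ?S (mtopology_of U) (\<lambda>k. k ?z)"
      unfolding S by (intro continuous_map_from_subtopology continuous_map_product_projection z)
    show "openin ?S (\<phi> ` W)"
    proof (subst openin_subopen, intro ballI)
      fix k assume "k \<in> \<phi> ` W"
      then obtain g where g: "g \<in> W" "k = \<phi> g" by blast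
      note W' = T[THEN iffD1, OF W]
      have gc: "g \<in> carrier G" using g(1) W' by blast
      obtain \<epsilon> where \<epsilon>: "0 < \<epsilon>" "\<And>h. h \<in> carrier G \<Longrightarrow> N (inv g \<otimes> h) < \<epsilon> \<Longrightarrow> h \<in> W"
        using W'[THEN conjunct2, THEN bspec, OF g(1)] by blast
      \<comment> \<open>A basic neighbourhood that restrains the image of one point only; by
        \<open>\<phi>_base_dist\<close> its members are the \<open>\<phi> h\<close> with
        \<open>N (inv g \<otimes> h)\<close> below \<epsilon>.\<close>
      let ?O = "{k \<in> topspace ?S. k ?z \<in> U.mball (\<phi> g ?z) \<epsilon>}"
      have "openin ?S ?O"
        using ev by (rule openin_continuous_map_preimage) (simp add: mtopology_of_def)
      moreover have "k \<in> ?O"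
        unfolding topS g(2) using gc z \<epsilon>(1) \<Phi>(1)[OF gc z] by (simp add: \<phi>_def)
      moreover have "?O \<subseteq> \<phi> ` W"
      proof
        fix k' assume k': "k' \<in> ?O"
        then obtain h where h: "h \<in> carrier G" "k' = \<phi> h" unfolding topS by blast
        then have "N (inv g \<otimes> h) < \<epsilon>" using k' \<phi>_base_dist[OF gc h(1)] by simp
        then show "k' \<in> \<phi> ` W" using \<epsilon>(2) h by blast
      qed
      ultimately show "\<exists>O'. openin ?S O' \<and> k \<in> O' \<and> O' \<subseteq> \<phi> ` W" by blast
    qed
  qed
  ultimately have "homeomorphic_map T ?S \<phi>"
    by (rule bijective_open_imp_homeomorphic_map) (simp_all only: topS top \<phi>_inj)
  then show ?thesis
    unfolding embeds_topologically_def using H \<open>\<phi> \<in> iso G (?K\<lparr>carrier := ?H\<rparr>)\<close> by blast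
qed

end

section \<open>Density of the matched points and the resulting action on \<open>U\<close>\<close>

theorem theorem6p1:
  fixes m :: "'k rel" and U :: "'u metric"
    and G :: "('g, 'b) monoid_scheme" and T :: "'g topology"
  assumes "Card_order m" and "cinfinite m"
    and "is_cardinal_sup {m ^c n | n :: 'k rel. Card_order n \<and> n <o m} m"
    and "urysohn_katetov m U"
    and "SIN_group G T" and "metrizable_space T" and "top_weight T \<le>o m"
  shows "embeds_topologically G T (isometry_group U) (isometry_topology U)"
proof -
  note m = assms(1,2) and UK = assms(4)
  obtain N where "group_length G N" and T: "\<And>S. openin T S \<longleftrightarrow> S \<subseteq> carrier G \<and>
      (\<forall>x\<in>S. \<exists>e>0. \<forall>y\<in>carrier G. N (inv\<^bsub>G\<^esub> x \<otimes>\<^bsub>G\<^esub> y) < e \<longrightarrow> y \<in> S)"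
    using SIN_group_length[OF assms(5,6)] by blast
  interpret group_length G N by fact
  interpret U: Metric_space "mspace U" "mdist U" by simp
  have top: "topspace T = carrier G"
    using assms(5) unfolding SIN_group_def topological_group_def by blast
  have complete: "mcomplete_of U" and weight: "top_weight (mtopology_of U) \<le>o m"
    using UK ordIso_iff_ordLeq unfolding urysohn_katetov_def by blast+
  have extension: "\<exists>z\<in>mspace U. \<forall>x\<in>S. mdist U z x = f x"
    if "S \<subseteq> mspace U" "|S| <o m" "katetov_on S (mdist U) f" for S f
    using that(3) by (intro urysohn_katetov_extension[OF m UK that(1,2)]) (auto simp: katetov_on_def)

  obtain Q where Q: "Q \<subseteq> mspace U" "|Q| \<le>o m"
      "\<And>W. openin (mtopology_of U) W \<Longrightarrow> W \<noteq> {} \<Longrightarrow> W \<inter> Q \<noteq> {}"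
    by (rule dense_subset_of_weight[OF weight, unfolded topspace_mtopology_of]) (rule that)
  \<comment> \<open>With no distance prescribed, \<open>extension\<close> merely provides a point,
    so \<open>U\<close> is nonempty and its dense subset can be listed along
    \<open>Field m\<close>.\<close>
  have "|{} :: 'u set| <o m" using m by (intro finite_ordLess_cinfinite) auto
  then have "mspace U \<noteq> {}" using extension[of "{}"] by (auto simp: katetov_on_def)
  moreover have "openin (mtopology_of U) (mspace U)" by (metis openin_topspace topspace_mtopology_of)
  ultimately have "Q \<noteq> {}" using Q(3) by blast
  moreover have "|Q| \<le>o |Field m|"
    using Q(2) ordIso_symmetric[OF card_of_Field_ordIso[OF m(1)]] by (rule ordLeq_ordIso_trans)
  ultimately have "\<exists>u. u ` Field m = Q" by (simp add: card_of_ordLeq2)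
  then obtain u where u: "u ` Field m = Q" by (rule exE)

  obtain B where B: "B \<subseteq> carrier G" "|B| \<le>o m" "\<And>W. openin T W \<Longrightarrow> W \<noteq> {} \<Longrightarrow> W \<inter> B \<noteq> {}"
    by (rule dense_subset_of_weight[OF assms(7), unfolded top]) (rule that)
  obtain e where e: "\<forall>a\<in>Field m. e a \<in> under m a \<times> insert \<one>\<^bsub>G\<^esub> B"
      "\<And>b x. b \<in> Field m \<Longrightarrow> x \<in> B \<Longrightarrow> \<exists>a\<in>Field m. e a = (b, x)"
    using bookkeeping[OF m B(2), of "\<one>\<^bsub>G\<^esub>"] by blast

  interpret back_and_forth G N m U u e
  proof
    fix a assume a: "a \<in> Field m"
    show "u a \<in> mspace U" using a u Q(1) by blast
    have "e a \<in> under m a \<times> insert \<one>\<^bsub>G\<^esub> B" using e(1) a by blast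
    then show "e a \<in> under m a \<times> carrier G" using B(1) by auto
  qed (use m extension in auto)
  let ?X = "Field m \<times> carrier G"
  obtain D R a where O: "orbits_pseudometric (Field m) D"
    and R: "R \<subseteq> ?X \<times> mspace U" and p: "distance_preserving D (mdist U) R"
    and range: "\<And>b. b \<in> Field m \<Longrightarrow> u b \<in> Range R" and domain: "\<And>b. b \<in> Field m \<Longrightarrow> e b \<in> Domain R"
    and a: "a \<in> Field m"
    and base: "\<And>g h. g \<in> carrier G \<Longrightarrow> h \<in> carrier G \<Longrightarrow> D (a, g) (a, h) = N (inv\<^bsub>G\<^esub> g \<otimes>\<^bsub>G\<^esub> h)"
    by (rule matching_exists) (rule that)
  note pD = orbits_pseudometric_D(1)[OF O]

  have ball: "openin T {y \<in> carrier G. N (inv\<^bsub>G\<^esub> g \<otimes>\<^bsub>G\<^esub> y) < \<epsilon>}" if g: "g \<in> carrier G" for g \<epsilon>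
    using T g by (rule openin_length_ball)
  have near: "\<exists>(s, s')\<in>R. D y s < \<epsilon>" if y: "y \<in> ?X" and \<epsilon>: "0 < \<epsilon>" for y \<epsilon>
  proof -
    obtain b g where bg: "y = (b, g)" "b \<in> Field m" "g \<in> carrier G" using y by blast
    have "g \<in> {y \<in> carrier G. N (inv\<^bsub>G\<^esub> g \<otimes>\<^bsub>G\<^esub> y) < \<epsilon>}" using bg \<epsilon> by simp
    then obtain h where h: "h \<in> B" "h \<in> carrier G" "N (inv\<^bsub>G\<^esub> g \<otimes>\<^bsub>G\<^esub> h) < \<epsilon>"
      using B(3)[OF ball[OF bg(3)]] by blast
    then obtain s' where s': "((b, h), s') \<in> R" using e(2)[OF bg(2) h(1)] domain by force
    \<comment> \<open>On a general orbit \<open>D (b, g) (b, h)\<close> is not given by a formula,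
      but \<open>?k\<close> carries \<open>(b, g)\<close> to \<open>(b, h)\<close>, and
      \<open>N ?k\<close> is the length of a conjugate of \<open>?k\<close>, namely the distance
      from \<open>g\<close> to \<open>h\<close> in the group.\<close>
    let ?k = "h \<otimes>\<^bsub>G\<^esub> inv\<^bsub>G\<^esub> g"
    have "D (b, h) (b, g) \<le> N ?k"
      using orbits_pseudometric_D(3)[OF O, of ?k "(b, g)"] bg h(2) by (simp add: act_def m_assoc)
    also have "N ?k = N (inv\<^bsub>G\<^esub> g \<otimes>\<^bsub>G\<^esub> h)"
      using N_conj[of g "inv\<^bsub>G\<^esub> g \<otimes>\<^bsub>G\<^esub> h"] bg(3) h(2) by (simp add: m_assoc[symmetric])
    finally have "D y (b, h) < \<epsilon>"
      using h bg pseudometric_on_D(2)[OF pD, of "(b, g)" "(b, h)"] by simp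
    then show ?thesis using s' by blast
  qed
  define \<psi> where "\<psi> y = (SOME z. z \<in> mspace U \<and> (\<forall>(s, s')\<in>R. mdist U z s' = D y s))" for y
  have \<psi>: "\<psi> y \<in> mspace U" "\<And>s s'. (s, s') \<in> R \<Longrightarrow> mdist U (\<psi> y) s' = D y s" if y: "y \<in> ?X" for y
  proof -
    have "\<exists>z. z \<in> mspace U \<and> (\<forall>(s, s')\<in>R. mdist U z s' = D y s)"
      using completion_point[OF pD complete R p y near[OF y]] by blast
    from someI_ex[OF this] show "\<psi> y \<in> mspace U" "\<And>s s'. (s, s') \<in> R \<Longrightarrow> mdist U (\<psi> y) s' = D y s"
      unfolding \<psi>_def by blast+
  qed
  interpret dense_action G N "Field m" D U \<psi> a
  proof
    show "mdist U (\<psi> x) (\<psi> y) = D x y" if "x \<in> ?X" "y \<in> ?X" for x y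
      by (rule completion_dist[OF pD pseudometric_on_mdist R that]) (rule \<psi> near that | assumption)+
    show "\<exists>x\<in>?X. mdist U w (\<psi> x) < \<epsilon>" if w: "w \<in> mspace U" and \<epsilon>: "0 < \<epsilon>" for w \<epsilon>
    proof -
      have "U.mball w \<epsilon> \<inter> Q \<noteq> {}" using w \<epsilon> by (intro Q(3)) (auto simp: mtopology_of_def)
      then obtain b where b: "b \<in> Field m" "mdist U w (u b) < \<epsilon>" using u by auto
      then obtain s where s: "(s, u b) \<in> R" using range by blast
      then have sX: "s \<in> ?X" and ub: "u b \<in> mspace U" using R by auto
      \<comment> \<open>On matched points \<psi> agrees with the matching, so its range contains
        every point of \<open>Q\<close> and is dense in \<open>U\<close>.\<close>
      have "mdist U (\<psi> s) (u b) = 0"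
        using \<psi>(2)[OF sX s] pseudometric_on_D(1)[OF pD sX] by simp
      then have "\<psi> s = u b" using \<psi>(1)[OF sX] ub by simp
      then show ?thesis using b(2) sX by (intro bexI[of _ s]) simp
    qed
  qed (use O complete \<psi>(1) a base in auto)
  show ?thesis using top T by (rule embeds_topologically_isometry_group)
qed

end
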